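(* Let $F$ be a holomorphic Hermitian line bundle on a compact K\"ahler manifold $X$. If the Hodge numbers of $X$ satisfy $h^{2,0}(X)\le h^{1,0}(X)$, then any generic holomorphic Yang-Mills connection on $F$ is flat.
   Context: $\Omega^k$ is the sheaf of holomorphic $k$-forms on $X$, ${\mathscr O}$ the sheaf of holomorphic functions. A holomorphic connection (gauge field) on $F$ is a morphism of abelian sheaves $\nabla:F\to\Omega^1(F)=\Omega^1\otimes_{\mathscr O}F$ satisfying $\nabla(f\sigma)=df\otimes\sigma+f\nabla\sigma$ for holomorphic $f$; it is flat if its curvature $K_\nabla$ vanishes. ${\mathfrak{hu}}(F)$ denotes the sheaf of holomorphic antihermitian endomorphisms of $F$, and $r_k:=\dim H^0(X,\Omega^k\otimes_{\mathscr O}{\mathfrak{hu}}(F))$; when $F$ is a line bundle, $r_2=\dim H^0(X,\Omega^2)=h^{2,0}(X)$ and $r_1=\dim H^0(X,\Omega^1)=h^{1,0}(X)$. The Yang-Mills functional on the set of holomorphic connections compatible with the Hermitian structure is $\nabla\mapsto\|K_\nabla\|^2$, the norm coming from the product $\langle\langle\cdot,\cdot\rangle\rangle$ on endomorphism-valued forms defined by the Hermitian metric on $F$ and the K\"ahler metric (via the $\star$ operator). Any other such connection is $\nabla+E$ with $E\in\Gamma(X,\Omega^1\otimes_{\mathscr O}{\mathfrak{hu}}(F))$, and $\nabla$ is a holomorphic Yang-Mills connection (field) if $\frac{d}{d\epsilon}\big|_{\epsilon=0}\|K_{\nabla+\epsilon E}\|^2=0$ for all such $E$, equivalently $\langle\langle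 K_\nabla,\nabla(E)\rangle\rangle=0$ for all $E$. When $r_2\le r_1$, $\nabla$ is called generic if the map $\nabla:H^0(X,\Omega^1\otimes_{\mathscr O}{\mathfrak{hu}}(F))\to H^0(X,\Omega^2\otimes_{\mathscr O}{\mathfrak{hu}}(F))$ is surjective. *)

theory Defs
  imports "HOL-Analysis.Analysis" "HOL-Library.Function_Algebras"
begin

section \<open>Holomorphic and smooth maps on open subsets of complex n-space\<close>

definition holomorphic_Cn :: "(complex^'n \<Rightarrow> complex) \<Rightarrow> (complex^'n) set \<Rightarrow> bool" where
  "holomorphic_Cn f S \<longleftrightarrow>
     (\<forall>z\<in>S. \<exists>f'. (f has_derivative f') (at z) \<and> (\<forall>a v. f' (a *s v) = a * f' v))"

text \<open>On an open set, all iterated directional derivatives up to order k exist and are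
  continuous, i.e. f is of class C^k in the real sense.\<close>

primrec Ck_on :: "nat \<Rightarrow> 'a::real_normed_vector set \<Rightarrow> ('a \<Rightarrow> 'b::real_normed_vector) \<Rightarrow> bool" where
  "Ck_on 0 S f \<longleftrightarrow> continuous_on S f"
| "Ck_on (Suc k) S f \<longleftrightarrow>
     (\<forall>x\<in>S. f differentiable (at x)) \<and> (\<forall>v. Ck_on k S (\<lambda>x. frechet_derivative f (at x) v))"

definition smooth_on :: "'a::real_normed_vector set \<Rightarrow> ('a \<Rightarrow> 'b::real_normed_vector) \<Rightarrow> bool" where
  "smooth_on S f \<longleftrightarrow> (\<forall>k. Ck_on k S f)"


section \<open>Complex manifolds\<close>

text \<open>The underlying space is the whole type 'x; the charts are indexed by 'c and the complex
  dimension is CARD('n). The value of chart_map outside chart_dom is irrelevant.\<close>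

record ('x, 'c, 'n) atlas =
  chart_dom :: "'c \<Rightarrow> 'x set"
  chart_map :: "'c \<Rightarrow> 'x \<Rightarrow> complex^'n"

definition chart_inv :: "('x,'c,'n::finite) atlas \<Rightarrow> 'c \<Rightarrow> complex^'n \<Rightarrow> 'x" where
  "chart_inv X c = inv_into (chart_dom X c) (chart_map X c)"

definition complex_manifold :: "('x::t2_space,'c,'n::finite) atlas \<Rightarrow> bool" where
  "complex_manifold X \<longleftrightarrow>
     (\<forall>c. open (chart_dom X c) \<and> open (chart_map X c ` chart_dom X c) \<and>
          homeomorphism (chart_dom X c) (chart_map X c ` chart_dom X c)
            (chart_map X c) (chart_inv X c)) \<and>
     (\<Union>c. chart_dom X c) = UNIV \<and>
     (\<forall>c d i. holomorphic_Cn (\<lambda>z. chart_map X d (chart_inv X c z) $ i)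
                (chart_map X c ` (chart_dom X c \<inter> chart_dom X d)))"

definition chart_deriv ::
    "('x,'c,'n::finite) atlas \<Rightarrow> 'c \<Rightarrow> ('x \<Rightarrow> 'b::real_normed_vector) \<Rightarrow> 'x \<Rightarrow> complex^'n \<Rightarrow> 'b" where
  "chart_deriv X c f x v = frechet_derivative (\<lambda>z. f (chart_inv X c z)) (at (chart_map X c x)) v"

text \<open>The tangent vector at x with components v in the chart c has components
  chart_jac X c d x v in the chart d.\<close>

definition chart_jac ::
    "('x,'c,'n::finite) atlas \<Rightarrow> 'c \<Rightarrow> 'c \<Rightarrow> 'x \<Rightarrow> complex^'n \<Rightarrow> complex^'n" where
  "chart_jac X c d x v = chart_deriv X c (chart_map X d) x v"


section \<open>Holomorphic functions and forms\<close>

text \<open>Sections over an open set V are represented by total functions that vanish outside V, so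
  that equality of functions is equality of sections.\<close>

definition hol_fun :: "('x,'c,'n::finite) atlas \<Rightarrow> 'x set \<Rightarrow> ('x \<Rightarrow> complex) set" where
  "hol_fun X V = {f. (\<forall>x. x \<notin> V \<longrightarrow> f x = 0) \<and>
     (\<forall>c. holomorphic_Cn (\<lambda>z. f (chart_inv X c z)) (chart_map X c ` (chart_dom X c \<inter> V)))}"

text \<open>A k-form assigns to a chart c, a point x of its domain, and a list of k tangent vectors
  (given by their components in c) a complex number.\<close>

type_synonym ('x, 'c, 'n) form = "'c \<Rightarrow> 'x \<Rightarrow> (complex^'n) list \<Rightarrow> complex"

definition hol_form :: "('x,'c,'n::finite) atlas \<Rightarrow> nat \<Rightarrow> 'x set \<Rightarrow> ('x,'c,'n) form set" where
  "hol_form X k V = {\<alpha>.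
     (\<forall>c x vs. x \<notin> chart_dom X c \<inter> V \<or> length vs \<noteq> k \<longrightarrow> \<alpha> c x vs = 0) \<and>
     (\<forall>c x vs i u w a b. x \<in> chart_dom X c \<inter> V \<and> length vs = k \<and> i < k \<longrightarrow>
        \<alpha> c x (vs[i := a *s u + b *s w]) = a * \<alpha> c x (vs[i := u]) + b * \<alpha> c x (vs[i := w])) \<and>
     (\<forall>c x vs i j. x \<in> chart_dom X c \<inter> V \<and> length vs = k \<and> i < j \<and> j < k \<and> vs ! i = vs ! j \<longrightarrow>
        \<alpha> c x vs = 0) \<and>
     (\<forall>c d x vs. x \<in> chart_dom X c \<inter> chart_dom X d \<inter> V \<longrightarrow>
        \<alpha> c x vs = \<alpha> d x (map (chart_jac X c d x) vs)) \<and>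
     (\<forall>c vs. holomorphic_Cn (\<lambda>z. \<alpha> c (chart_inv X c z) vs)
        (chart_map X c ` (chart_dom X c \<inter> V)))}"

text \<open>The Hodge number of type (p,0), i.e. the complex dimension of the space of global
  holomorphic p-forms.\<close>

definition hodge_number_p0 :: "('x,'c,'n::finite) atlas \<Rightarrow> nat \<Rightarrow> nat" where
  "hodge_number_p0 X p = vector_space.dim
     (\<lambda>(a::complex) (\<alpha>::('x,'c,'n) form). (\<lambda>c x vs. a * \<alpha> c x vs)) (hol_form X p UNIV)"

definition form_of_fun :: "('x,'c,'n::finite) atlas \<Rightarrow> ('x \<Rightarrow> complex) \<Rightarrow> ('x,'c,'n) form" where
  "form_of_fun X f c x vs = (if x \<in> chart_dom X c \<and> vs = [] then f x else 0)"

definition remove_nth :: "nat \<Rightarrow> 'a list \<Rightarrow> 'a list" where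
  "remove_nth j vs = take j vs @ drop (Suc j) vs"

definition ext_deriv ::
    "('x,'c,'n::finite) atlas \<Rightarrow> 'x set \<Rightarrow> ('x,'c,'n) form \<Rightarrow> ('x,'c,'n) form" where
  "ext_deriv X V \<alpha> c x vs =
     (if x \<in> chart_dom X c \<inter> V
      then \<Sum>j<length vs. (-1) ^ j * chart_deriv X c (\<lambda>y. \<alpha> c y (remove_nth j vs)) x (vs ! j)
      else 0)"

text \<open>Wedge product of a 1-form with a k-form.\<close>

definition wedge1 :: "('x,'c,'n) form \<Rightarrow> ('x,'c,'n) form \<Rightarrow> ('x,'c,'n) form" where
  "wedge1 \<alpha> \<beta> c x vs = (\<Sum>j<length vs. (-1) ^ j * \<alpha> c x [vs ! j] * \<beta> c x (remove_nth j vs))"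

definition restrict_to :: "'x set \<Rightarrow> ('x \<Rightarrow> 'b::zero) \<Rightarrow> 'x \<Rightarrow> 'b" where
  "restrict_to V f x = (if x \<in> V then f x else 0)"


section \<open>Holomorphic Hermitian line bundles\<close>

text \<open>A line bundle is given by an open cover (triv_dom i) over which it is trivial and by its
  transition functions: a section s has components s i with s i = trans_fun i j * s j.\<close>

record ('x, 'i) line_bundle =
  triv_dom :: "'i \<Rightarrow> 'x set"
  trans_fun :: "'i \<Rightarrow> 'i \<Rightarrow> 'x \<Rightarrow> complex"

definition hol_line_bundle ::
    "('x::t2_space,'c,'n::finite) atlas \<Rightarrow> ('x,'i) line_bundle \<Rightarrow> bool" where
  "hol_line_bundle X F \<longleftrightarrow>
     (\<forall>i. open (triv_dom F i)) \<and> (\<Union>i. triv_dom F i) = UNIV \<and>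
     (\<forall>i j. restrict_to (triv_dom F i \<inter> triv_dom F j) (trans_fun F i j)
              \<in> hol_fun X (triv_dom F i \<inter> triv_dom F j)) \<and>
     (\<forall>i. \<forall>x \<in> triv_dom F i. trans_fun F i i x = 1) \<and>
     (\<forall>i j k. \<forall>x \<in> triv_dom F i \<inter> triv_dom F j \<inter> triv_dom F k.
        trans_fun F i j x * trans_fun F j k x = trans_fun F i k x)"

text \<open>The metric is given by the functions h i, the squared norm of the i-th local frame; on the
  fibre over x the product of two vectors with components a and b is h i x * a * cnj b.\<close>

definition hermitian_line_bundle ::
    "('x::t2_space,'c,'n::finite) atlas \<Rightarrow> ('x,'i) line_bundle \<Rightarrow> ('i \<Rightarrow> 'x \<Rightarrow> real) \<Rightarrow> bool" where
  "hermitian_line_bundle X F h \<longleftrightarrow> hol_line_bundle X F \<and>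
     (\<forall>i. \<forall>x \<in> triv_dom F i. h i x > 0) \<and>
     (\<forall>i j. \<forall>x \<in> triv_dom F i \<inter> triv_dom F j. h j x = h i x * (cmod (trans_fun F i j x))\<^sup>2) \<and>
     (\<forall>i c. smooth_on (chart_map X c ` (chart_dom X c \<inter> triv_dom F i)) (\<lambda>z. h i (chart_inv X c z)))"

type_synonym ('x, 'i) sect = "'i \<Rightarrow> 'x \<Rightarrow> complex"
type_synonym ('x, 'i, 'c, 'n) fform = "'i \<Rightarrow> ('x,'c,'n) form"

definition hol_sect ::
    "('x,'c,'n::finite) atlas \<Rightarrow> ('x,'i) line_bundle \<Rightarrow> 'x set \<Rightarrow> ('x,'i) sect set" where
  "hol_sect X F V = {s. (\<forall>i. s i \<in> hol_fun X (V \<inter> triv_dom F i)) \<and>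
     (\<forall>i j. \<forall>x \<in> V \<inter> triv_dom F i \<inter> triv_dom F j. s i x = trans_fun F i j x * s j x)}"

definition hol_fform ::
    "('x,'c,'n::finite) atlas \<Rightarrow> ('x,'i) line_bundle \<Rightarrow> nat \<Rightarrow> 'x set \<Rightarrow> ('x,'i,'c,'n) fform set" where
  "hol_fform X F k V = {\<tau>. (\<forall>i. \<tau> i \<in> hol_form X k (V \<inter> triv_dom F i)) \<and>
     (\<forall>i j c vs. \<forall>x \<in> V \<inter> triv_dom F i \<inter> triv_dom F j.
        \<tau> i c x vs = trans_fun F i j x * \<tau> j c x vs)}"

definition tensor_sect :: "('x,'c,'n) form \<Rightarrow> ('x,'i) sect \<Rightarrow> ('x,'i,'c,'n) fform" where
  "tensor_sect \<alpha> s i c x vs = \<alpha> c x vs * s i x"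

text \<open>The section of F over triv_dom F i whose i-th component is 1.\<close>

definition local_frame :: "('x,'i) line_bundle \<Rightarrow> 'i \<Rightarrow> ('x,'i) sect" where
  "local_frame F i j x = (if x \<in> triv_dom F i \<inter> triv_dom F j then trans_fun F j i x else 0)"

text \<open>Endomorphisms of a line bundle are multiplications by functions; accordingly the sheaf
  End(F) is identified with the structure sheaf, and End(F)-valued forms with scalar forms.\<close>

definition antiherm_end ::
    "('x,'c,'n::finite) atlas \<Rightarrow> ('x,'i) line_bundle \<Rightarrow> ('i \<Rightarrow> 'x \<Rightarrow> real) \<Rightarrow> 'x set \<Rightarrow> ('x \<Rightarrow> complex) set" where
  "antiherm_end X F h V = {\<phi> \<in> hol_fun X V. \<forall>i a b. \<forall>x \<in> V \<inter> triv_dom F i.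
     complex_of_real (h i x) * (\<phi> x * a) * cnj b = - (complex_of_real (h i x) * a * cnj (\<phi> x * b))}"

text \<open>Sections over V of the tensor product of the k-forms with the sheaf of antihermitian
  endomorphisms: the End(F)-valued holomorphic k-forms that locally are finite sums of products
  of a holomorphic k-form and a holomorphic antihermitian endomorphism. (The antihermitian
  endomorphisms are not closed under multiplication by holomorphic functions; tensoring with the
  k-forms over the holomorphic functions means passing to the module they generate. For a line
  bundle its global sections form a space of dimension hodge_number_p0 X k.)\<close>

definition antiherm_form ::
    "('x::t2_space,'c,'n::finite) atlas \<Rightarrow> ('x,'i) line_bundle \<Rightarrow> ('i \<Rightarrow> 'x \<Rightarrow> real) \<Rightarrow> nat \<Rightarrow> 'x set
      \<Rightarrow> ('x,'c,'n) form set" where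
  "antiherm_form X F h k V = {\<alpha> \<in> hol_form X k V. \<forall>x\<in>V. \<exists>W. open W \<and> x \<in> W \<and> W \<subseteq> V \<and>
     (\<exists>(m::nat) \<omega> \<phi>. (\<forall>j<m. \<omega> j \<in> hol_form X k W \<and> \<phi> j \<in> antiherm_end X F h W) \<and>
        (\<forall>c vs. \<forall>y\<in>W. \<alpha> c y vs = (\<Sum>j<m. \<omega> j c y vs * \<phi> j y)))}"


section \<open>Holomorphic connections\<close>

type_synonym ('x, 'i, 'c, 'n) conn = "'x set \<Rightarrow> ('x,'i) sect \<Rightarrow> ('x,'i,'c,'n) fform"

text \<open>A morphism of sheaves of abelian groups satisfying the Leibniz rule.\<close>

definition hol_connection ::
    "('x::t2_space,'c,'n::finite) atlas \<Rightarrow> ('x,'i) line_bundle \<Rightarrow> ('x,'i,'c,'n) conn \<Rightarrow> bool" where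
  "hol_connection X F D \<longleftrightarrow> (\<forall>V. open V \<longrightarrow>
     (\<forall>s \<in> hol_sect X F V. D V s \<in> hol_fform X F 1 V) \<and>
     (\<forall>s \<in> hol_sect X F V. \<forall>t \<in> hol_sect X F V. D V (s + t) = D V s + D V t) \<and>
     (\<forall>s \<in> hol_sect X F V. \<forall>W. open W \<and> W \<subseteq> V \<longrightarrow>
        D W (\<lambda>i. restrict_to W (s i)) = (\<lambda>i c. restrict_to W (D V s i c))) \<and>
     (\<forall>f \<in> hol_fun X V. \<forall>s \<in> hol_sect X F V.
        D V (\<lambda>i x. f x * s i x) =
          tensor_sect (ext_deriv X V (form_of_fun X f)) s + (\<lambda>i c x vs. f x * D V s i c x vs)))"

definition connection_form ::
    "('x,'i) line_bundle \<Rightarrow> ('x,'i,'c,'n) conn \<Rightarrow> 'i \<Rightarrow> ('x,'c,'n) form" where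
  "connection_form F D i = D (triv_dom F i) (local_frame F i) i"

text \<open>Extension of the connection to F-valued k-forms by
  D(alpha (x) s) = d alpha (x) s + (-1)^k alpha /\ D s, evaluated on alpha (x) local_frame F i.\<close>

definition conn_ext ::
    "('x,'c,'n::finite) atlas \<Rightarrow> ('x,'i) line_bundle \<Rightarrow> ('x,'i,'c,'n) conn \<Rightarrow> 'x set
      \<Rightarrow> ('x,'i,'c,'n) fform \<Rightarrow> ('x,'i,'c,'n) fform" where
  "conn_ext X F D V \<tau> i = ext_deriv X (V \<inter> triv_dom F i) (\<tau> i) + wedge1 (connection_form F D i) (\<tau> i)"

definition curvature ::
    "('x,'c,'n::finite) atlas \<Rightarrow> ('x,'i) line_bundle \<Rightarrow> ('x,'i,'c,'n) conn \<Rightarrow> ('x,'i,'c,'n) conn" where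
  "curvature X F D V s = conn_ext X F D V (D V s)"

definition flat_connection ::
    "('x::t2_space,'c,'n::finite) atlas \<Rightarrow> ('x,'i) line_bundle \<Rightarrow> ('x,'i,'c,'n) conn \<Rightarrow> bool" where
  "flat_connection X F D \<longleftrightarrow> (\<forall>V. open V \<longrightarrow> (\<forall>s \<in> hol_sect X F V. curvature X F D V s = 0))"

text \<open>The End(F)-valued 2-form representing an operator T from F to F-valued 2-forms that is
  linear over the holomorphic functions.\<close>

definition end_form ::
    "('x::t2_space,'c,'n::finite) atlas \<Rightarrow> ('x,'i) line_bundle \<Rightarrow> ('x,'i,'c,'n) conn \<Rightarrow> ('x,'c,'n) form" where
  "end_form X F T = (THE \<kappa>. \<kappa> \<in> hol_form X 2 UNIV \<and>
     (\<forall>V. open V \<longrightarrow> (\<forall>s \<in> hol_sect X F V. T V s = tensor_sect \<kappa> s)))"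

definition curvature_form ::
    "('x::t2_space,'c,'n::finite) atlas \<Rightarrow> ('x,'i) line_bundle \<Rightarrow> ('x,'i,'c,'n) conn \<Rightarrow> ('x,'c,'n) form" where
  "curvature_form X F D = end_form X F (curvature X F D)"

text \<open>The induced connection on End(F), applied to an End(F)-valued 1-form E; it is determined by
  D(E s) = (D E) s - E /\ D s.\<close>

definition conn_end ::
    "('x::t2_space,'c,'n::finite) atlas \<Rightarrow> ('x,'i) line_bundle \<Rightarrow> ('x,'i,'c,'n) conn
      \<Rightarrow> ('x,'c,'n) form \<Rightarrow> ('x,'c,'n) form" where
  "conn_end X F D E = end_form X F
     (\<lambda>V s. conn_ext X F D V (tensor_sect E s) + (\<lambda>i. wedge1 E (D V s i)))"

definition conn_add ::
    "('x,'i,'c,'n) conn \<Rightarrow> ('x,'c,'n) form \<Rightarrow> ('x,'i,'c,'n) conn" where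
  "conn_add D E V s = D V s + tensor_sect E s"

definition generic_connection ::
    "('x::t2_space,'c,'n::finite) atlas \<Rightarrow> ('x,'i) line_bundle \<Rightarrow> ('i \<Rightarrow> 'x \<Rightarrow> real)
      \<Rightarrow> ('x,'i,'c,'n) conn \<Rightarrow> bool" where
  "generic_connection X F h D \<longleftrightarrow>
     conn_end X F D ` antiherm_form X F h 1 UNIV = antiherm_form X F h 2 UNIV"


section \<open>Kaehler metrics\<close>

text \<open>g c x u v is the Hermitian product, linear in u and antilinear in v, of the tangent vectors
  at x with components u and v in the chart c. The Riemannian metric is its real part, the
  Kaehler form is minus its imaginary part, and the last clause says that the latter is closed.\<close>

type_synonym ('x, 'c, 'n) herm_metric = "'c \<Rightarrow> 'x \<Rightarrow> complex^'n \<Rightarrow> complex^'n \<Rightarrow> complex"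

definition kaehler_metric ::
    "('x::t2_space,'c,'n::finite) atlas \<Rightarrow> ('x,'c,'n) herm_metric \<Rightarrow> bool" where
  "kaehler_metric X g \<longleftrightarrow>
     (\<forall>c. \<forall>x \<in> chart_dom X c.
        (\<forall>a b u v w. g c x (a *s u + b *s v) w = a * g c x u w + b * g c x v w) \<and>
        (\<forall>u v. g c x v u = cnj (g c x u v)) \<and>
        (\<forall>u. u \<noteq> 0 \<longrightarrow> Re (g c x u u) > 0)) \<and>
     (\<forall>c d u v. \<forall>x \<in> chart_dom X c \<inter> chart_dom X d.
        g c x u v = g d x (chart_jac X c d x u) (chart_jac X c d x v)) \<and>
     (\<forall>c u v. smooth_on (chart_map X c ` chart_dom X c) (\<lambda>z. g c (chart_inv X c z) u v)) \<and>
     (\<forall>c u v w. \<forall>x \<in> chart_dom X c.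
        chart_deriv X c (\<lambda>y. - Im (g c y v w)) x u +
        chart_deriv X c (\<lambda>y. - Im (g c y w u)) x v +
        chart_deriv X c (\<lambda>y. - Im (g c y u v)) x w = 0)"

definition compact_kaehler_manifold ::
    "('x::t2_space,'c,'n::finite) atlas \<Rightarrow> ('x,'c,'n) herm_metric \<Rightarrow> bool" where
  "compact_kaehler_manifold X g \<longleftrightarrow>
     complex_manifold X \<and> compact (UNIV :: 'x set) \<and> kaehler_metric X g"

definition gram :: "('x,'c,'n::finite) herm_metric \<Rightarrow> 'c \<Rightarrow> 'x \<Rightarrow> complex^'n^'n" where
  "gram g c x = (\<chi> j k. g c x (axis j 1) (axis k 1))"

text \<open>Integration against the Riemannian volume, which in a chart is det (gram g c) times
  Lebesgue measure: the space is cut into finitely many Borel pieces, each with closure in a chart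
  domain (such a partition exists since the space is compact). The integrand may be given by a
  chart-dependent expression f c; if f c x does not depend on c, the value does not depend on the
  partition, by the change of variables formula.\<close>

definition chart_partition ::
    "('x::t2_space,'c,'n::finite) atlas \<Rightarrow> ('c \<times> 'x set) set \<Rightarrow> bool" where
  "chart_partition X P \<longleftrightarrow> finite P \<and>
     (\<forall>(c,B) \<in> P. B \<in> sets borel \<and> closure B \<subseteq> chart_dom X c) \<and>
     (\<forall>p\<in>P. \<forall>q\<in>P. p \<noteq> q \<longrightarrow> snd p \<inter> snd q = {}) \<and>
     (\<Union>p\<in>P. snd p) = UNIV"

definition volume_integral ::
    "('x::t2_space,'c,'n::finite) atlas \<Rightarrow> ('x,'c,'n) herm_metric \<Rightarrow> ('c \<Rightarrow> 'x \<Rightarrow> complex) \<Rightarrow> complex" where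
  "volume_integral X g f = (\<Sum>(c,B) \<in> (SOME P. chart_partition X P).
     (LINT z : chart_map X c ` B | lborel.
        f c (chart_inv X c z) * det (gram g c (chart_inv X c z))))"

text \<open>The Hermitian product induced by g on 2-forms of type (2,0), in terms of the inverse of the
  Gram matrix; for a g-unitary basis e it is the sum over j < k of
  alpha(e_j,e_k) * cnj (beta(e_j,e_k)).\<close>

definition form2_inner ::
    "('x,'c,'n::finite) herm_metric \<Rightarrow> ('x,'c,'n) form \<Rightarrow> ('x,'c,'n) form \<Rightarrow> 'c \<Rightarrow> 'x \<Rightarrow> complex" where
  "form2_inner g \<alpha> \<beta> c x = (let G = matrix_inv (gram g c x) in
     (1/2) * (\<Sum>j\<in>UNIV. \<Sum>k\<in>UNIV. \<Sum>l\<in>UNIV. \<Sum>m\<in>UNIV. G $ l $ j * G $ m $ k *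
       \<alpha> c x [axis j 1, axis k 1] * cnj (\<beta> c x [axis l 1, axis m 1])))"

text \<open>The global product of End(F)-valued 2-forms, i.e. the integral of the trace of alpha wedge
  the Hodge star of the adjoint of beta. The adjoint of the multiplication by a number is the
  multiplication by its conjugate, whatever the Hermitian metric on the line bundle F is, so that
  metric does not occur in the formula.\<close>

definition L2_inner ::
    "('x::t2_space,'c,'n::finite) atlas \<Rightarrow> ('x,'c,'n) herm_metric
      \<Rightarrow> ('x,'c,'n) form \<Rightarrow> ('x,'c,'n) form \<Rightarrow> complex" where
  "L2_inner X g \<alpha> \<beta> = volume_integral X g (form2_inner g \<alpha> \<beta>)"

definition yang_mills_functional ::
    "('x::t2_space,'c,'n::finite) atlas \<Rightarrow> ('x,'c,'n) herm_metric \<Rightarrow> ('x,'i) line_bundle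
      \<Rightarrow> ('x,'i,'c,'n) conn \<Rightarrow> real" where
  "yang_mills_functional X g F D = Re (L2_inner X g (curvature_form X F D) (curvature_form X F D))"

text \<open>The connections compatible with the Hermitian structure are, as soon as there is one, all
  the D + E with E a global section of the 1-forms with values in the antihermitian endomorphisms
  (in the sense of antiherm_form). For a line bundle these E are all global holomorphic 1-forms,
  and so every holomorphic connection is of this kind: compatibility is no further condition.\<close>

definition yang_mills_connection ::
    "('x::t2_space,'c,'n::finite) atlas \<Rightarrow> ('x,'c,'n) herm_metric \<Rightarrow> ('x,'i) line_bundle
      \<Rightarrow> ('i \<Rightarrow> 'x \<Rightarrow> real) \<Rightarrow> ('x,'i,'c,'n) conn \<Rightarrow> bool" where
  "yang_mills_connection X g F h D \<longleftrightarrow> hol_connection X F D \<and>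
     (\<forall>E \<in> antiherm_form X F h 1 UNIV.
        ((\<lambda>\<epsilon>::real. yang_mills_functional X g F
            (conn_add D (\<lambda>c x vs. complex_of_real \<epsilon> * E c x vs))) has_real_derivative 0) (at 0))"

end

theory Submission
  imports Defs "HOL-Complex_Analysis.Cauchy_Integral_Formula"
begin

text \<open>On a line bundle every \<open>End(F)\<close>-valued form is a scalar form, the curvature is a global
  holomorphic 2-form \<open>\<kappa>\<close> that is locally \<open>dA\<close> for the connection form \<open>A\<close>, the induced connection on
  \<open>End(F)\<close> is the exterior derivative, and \<open>D + E\<close> has curvature \<open>\<kappa> + dE\<close>. Genericity yields a global
  holomorphic 1-form \<open>E\<close> with \<open>dE = \<kappa>\<close>, so that \<open>D + \<epsilon>E\<close> has Yang-Mills energy \<open>(1 + \<epsilon>)\<^sup>2 \<parallel>\<kappa>\<parallel>\<^sup>2\<close>; the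
  Yang-Mills condition in this direction reads \<open>2 \<parallel>\<kappa>\<parallel>\<^sup>2 = 0\<close>.\<close>

section \<open>Several complex variables\<close>

text \<open>Two obstacles shape the proof. Holomorphy means only differentiability at each point
  with complex linear derivative; that \<open>d\<close> of a holomorphic form is holomorphic, and
  that second derivatives commute, is extracted from Cauchy's formula on complex lines. And the
  energy is a sum of integrals over one chosen partition, each piece being seen in a single chart;
  its definiteness requires existence of a partition, integrability on the pieces, and a transport
  of null sets between charts. Genericity applies to \<kappa> because \<alpha> = (-i \<alpha>) i,
  with i a constant antihermitian endomorphism, puts every holomorphic form into the module that
  such endomorphisms generate. Adding E changes the curvature by dE alone, since E wedge E = 0 for
  scalar forms; with dE = \<kappa> the line D + \<epsilon>E passes through a flat connection at
  \<epsilon> = -1, whence the factor (1 + \<epsilon>) squared. \<open>curvature_form\<close> and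
  \<open>conn_end\<close> are definite descriptions: evaluating them means exhibiting a global
  holomorphic 2-form that represents the operator.\<close>

lemma holomorphic_Cn_has_derivative:
  assumes "holomorphic_Cn f S" "z \<in> S"
  shows "(f has_derivative frechet_derivative f (at z)) (at z)"
  using assms unfolding holomorphic_Cn_def by (meson differentiableI frechet_derivative_works)

lemma holomorphic_Cn_derivative_scale:
  assumes "holomorphic_Cn f S" "z \<in> S"
  shows "frechet_derivative f (at z) (a *s v) = a * frechet_derivative f (at z) v"
  using assms unfolding holomorphic_Cn_def by (metis frechet_derivative_at)

lemma holomorphic_Cn_derivative_add:
  assumes "holomorphic_Cn f S" "z \<in> S"
  shows "frechet_derivative f (at z) (u + v) = frechet_derivative f (at z) u + frechet_derivative f (at z) v"
  using holomorphic_Cn_has_derivative[OF assms] by (meson has_derivative_bounded_linear linear_simps(1))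

lemma holomorphic_Cn_subset: "holomorphic_Cn f S \<Longrightarrow> T \<subseteq> S \<Longrightarrow> holomorphic_Cn f T"
  unfolding holomorphic_Cn_def by blast

lemma holomorphic_Cn_continuous_on: "holomorphic_Cn f S \<Longrightarrow> continuous_on S f"
  by (meson continuous_at_imp_continuous_on differentiableI differentiable_imp_continuous_within
      holomorphic_Cn_has_derivative)

text \<open>\<open>frechet_derivative\<close> is a choice from the predicate
  \<open>has_derivative\<close>. Local agreement makes the two predicates equal, hence also the two
  choices, even where no derivative exists.\<close>

lemma frechet_derivative_cong_open:
  assumes "open S" "z \<in> S" "\<And>y. y \<in> S \<Longrightarrow> f y = g y"
  shows "frechet_derivative f (at z) = frechet_derivative g (at z)"
proof -
  have "(f has_derivative D) (at z) \<longleftrightarrow> (g has_derivative D) (at z)" for D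
    by (rule iffI; erule has_derivative_transform_within_open[OF _ assms(1,2)]; simp add: assms(3))
  then show ?thesis unfolding frechet_derivative_def by simp
qed

lemma holomorphic_Cn_cong:
  assumes "open S" "\<And>y. y \<in> S \<Longrightarrow> f y = g y" "holomorphic_Cn f S"
  shows "holomorphic_Cn g S"
  unfolding holomorphic_Cn_def
proof
  fix z assume "z \<in> S"
  then obtain f' where f': "(f has_derivative f') (at z)" "\<forall>a v. f' (a *s v) = a * f' v"
    using assms(3) unfolding holomorphic_Cn_def by blast
  have "(g has_derivative f') (at z)"
    by (rule has_derivative_transform_within_open[OF f'(1) assms(1) \<open>z \<in> S\<close> assms(2)])
  with f'(2) show "\<exists>f'. (g has_derivative f') (at z) \<and> (\<forall>a v. f' (a *s v) = a * f' v)"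
    by blast
qed

lemma holomorphic_Cn_const: "holomorphic_Cn (\<lambda>z. c) S"
  unfolding holomorphic_Cn_def by (auto intro!: exI[of _ "\<lambda>_. 0"])

lemma holomorphic_Cn_add:
  assumes "holomorphic_Cn f S" "holomorphic_Cn g S"
  shows "holomorphic_Cn (\<lambda>z. f z + g z) S"
  unfolding holomorphic_Cn_def
proof
  fix z assume z: "z \<in> S"
  note D = holomorphic_Cn_has_derivative[OF assms(1) z] holomorphic_Cn_has_derivative[OF assms(2) z]
  show "\<exists>f'. ((\<lambda>z. f z + g z) has_derivative f') (at z) \<and> (\<forall>a v. f' (a *s v) = a * f' v)"
    by (intro exI conjI allI, rule has_derivative_add[OF D])
      (simp add: holomorphic_Cn_derivative_scale[OF assms(1) z] holomorphic_Cn_derivative_scale[OF assms(2) z] distrib_left)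
qed

lemma holomorphic_Cn_mult:
  assumes "holomorphic_Cn f S" "holomorphic_Cn g S"
  shows "holomorphic_Cn (\<lambda>z. f z * g z) S"
  unfolding holomorphic_Cn_def
proof
  fix z assume z: "z \<in> S"
  note D = holomorphic_Cn_has_derivative[OF assms(1) z] holomorphic_Cn_has_derivative[OF assms(2) z]
  show "\<exists>f'. ((\<lambda>z. f z * g z) has_derivative f') (at z) \<and> (\<forall>a v. f' (a *s v) = a * f' v)"
    by (intro exI conjI allI, rule has_derivative_mult[OF D])
      (simp add: holomorphic_Cn_derivative_scale[OF assms(1) z] holomorphic_Cn_derivative_scale[OF assms(2) z] algebra_simps)
qed

section \<open>Restriction to complex lines and Cauchy's formula\<close>

lemma norm_smult_vec: "norm (a *s (v::complex^'n::finite)) = norm a * norm v"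
  by (simp add: norm_vec_def norm_mult L2_set_right_distrib)

lemma has_derivative_complex_line:
  "((\<lambda>t. z + t *s (v::complex^'n::finite)) has_derivative (\<lambda>t. t *s v)) (at t0 within T)"
proof -
  have "bounded_linear (\<lambda>t. t *s v)"
    by (rule bounded_linear_intro[where K="norm v"])
      (simp_all add: norm_smult_vec vec_eq_iff algebra_simps)
  then show ?thesis
    by (auto intro!: derivative_eq_intros bounded_linear_imp_has_derivative)
qed

lemma continuous_on_smult_vec [continuous_intros]:
  fixes v :: "'a::topological_space \<Rightarrow> complex^'n::finite"
  assumes "continuous_on T f" "continuous_on T v"
  shows "continuous_on T (\<lambda>x. f x *s v x)"
  unfolding vector_scalar_mult_def using assms by (intro continuous_intros)

text \<open>Complex linearity of the derivative is exactly what makes the slice of \<open>f\<close>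
  along a complex line complex differentiable, so that one-variable theory applies to it.\<close>

lemma holomorphic_Cn_has_field_derivative_line:
  assumes "holomorphic_Cn f S" "z + t0 *s v \<in> S"
  shows "((\<lambda>t. f (z + t *s v)) has_field_derivative frechet_derivative f (at (z + t0 *s v)) v) (at t0)"
proof -
  have "((\<lambda>t. f (z + t *s v)) has_derivative (\<lambda>t. frechet_derivative f (at (z + t0 *s v)) (t *s v))) (at t0)"
    by (rule has_derivative_compose[OF has_derivative_complex_line])
      (rule holomorphic_Cn_has_derivative[OF assms])
  moreover have "(\<lambda>t. frechet_derivative f (at (z + t0 *s v)) (t *s v)) = (*) (frechet_derivative f (at (z + t0 *s v)) v)"
    by (rule ext) (simp add: holomorphic_Cn_derivative_scale[OF assms])
  ultimately show ?thesis by (simp add: has_field_derivative_def)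
qed

text \<open>Cauchy's integrand for the derivative at 0 of the slice F through \<open>z\<close> in
  direction \<open>v\<close>. On the circle u = \<open>r * cis (2 * pi * t)\<close> one has du = 2
  pi i u dt, so F(u) / u^2 du / (2 pi i) becomes F(u) / u dt: hence a single division and no
  prefactor.\<close>

definition circle_integrand :: "real \<Rightarrow> complex^'n \<Rightarrow> (complex^'n \<Rightarrow> complex) \<Rightarrow> complex^'n \<Rightarrow> real \<Rightarrow> complex"
  where "circle_integrand r v f z t = f (z + (r * cis (2 * pi * t)) *s v) / (r * cis (2 * pi * t))"

lemma has_integral_mult_cancel:
  fixes k :: complex
  assumes "((\<lambda>t. k * f t) has_integral k * I) S" "k \<noteq> 0"
  shows "(f has_integral I) S"
  using has_integral_mult_right[OF assms(1), of "inverse k"] assms(2)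
  by (simp add: mult.assoc[symmetric])

text \<open>The slice is holomorphic on the closed disc, and its derivative at 0 is the directional
  derivative. The integral contains \<open>f\<close> undifferentiated, which is the lever for all
  regularity results.\<close>

lemma holomorphic_Cn_Cauchy:
  fixes f :: "complex^'n::finite \<Rightarrow> complex"
  assumes f: "holomorphic_Cn f S" and "r > 0"
    and S: "\<And>t. cmod t \<le> r \<Longrightarrow> z + t *s v \<in> S"
  shows "frechet_derivative f (at z) v = integral {0..1} (circle_integrand r v f z)"
proof -
  define F where "F t = f (z + t *s v)" for t
  have D: "(F has_field_derivative frechet_derivative f (at (z + t *s v)) v) (at t)" if "cmod t \<le> r" for t
    unfolding F_def using holomorphic_Cn_has_field_derivative_line[OF f S[OF that]] .
  have "F field_differentiable at t" if "cmod t \<le> r" for t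
    using D[OF that] field_differentiable_def by blast
  then have hol: "F holomorphic_on cball 0 r"
    unfolding holomorphic_on_def by (simp add: field_differentiable_at_within)
  \<comment> \<open>Cauchy's formula for the derivative of order 1, hence the exponent 2.\<close>
  have c: "((\<lambda>u. F u / u ^ 2) has_contour_integral (2 * pi * \<i>) * deriv F 0) (circlepath 0 r)"
    using Cauchy_has_contour_integral_higher_derivative_circlepath[of 0 r F 0 1]
      hol holomorphic_on_imp_continuous_on[OF hol] \<open>r > 0\<close>
    by (simp add: holomorphic_on_subset[OF hol ball_subset_cball] power2_eq_square)
  have "deriv F 0 = frechet_derivative f (at z) v"
    using D[of 0] \<open>r > 0\<close> by (simp add: DERIV_imp_deriv)
  with c have "((\<lambda>t. F (circlepath 0 r t) / (circlepath 0 r t)^2 * vector_derivative (circlepath 0 r) (at t))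
     has_integral (2 * pi * \<i>) * frechet_derivative f (at z) v) {0..1}"
    by (simp add: has_contour_integral)
  moreover have "F (circlepath 0 r t) / (circlepath 0 r t)^2 * vector_derivative (circlepath 0 r) (at t)
     = (2 * pi * \<i>) * circle_integrand r v f z t" for t
  proof -
    have e: "circlepath 0 r t = r * cis (2 * pi * t)"
      by (simp add: circlepath cis_conv_exp mult_ac)
    have "vector_derivative (circlepath 0 r) (at t) = (2 * pi * \<i>) * (r * cis (2 * pi * t))"
      by (simp add: vector_derivative_circlepath cis_conv_exp mult_ac)
    then show ?thesis
      unfolding e using \<open>r > 0\<close>
      by (simp add: F_def circle_integrand_def power2_eq_square)
  qed
  ultimately have "((\<lambda>t. (2 * pi * \<i>) * circle_integrand r v f z t)
     has_integral (2 * pi * \<i>) * frechet_derivative f (at z) v) {0..1}"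
    by simp
  then have "(circle_integrand r v f z has_integral frechet_derivative f (at z) v) {0..1}"
    by (rule has_integral_mult_cancel) simp
  then show ?thesis by (simp add: integral_unique)
qed

lemma continuous_on_circle_integrand:
  fixes f :: "complex^'n::finite \<Rightarrow> complex"
  assumes "continuous_on S f" "r > 0"
    and "\<And>z t. z \<in> U \<Longrightarrow> cmod t \<le> r \<Longrightarrow> z + t *s v \<in> S"
  shows "continuous_on (U \<times> cbox 0 1) (\<lambda>(z, t). circle_integrand r v f z t)"
  unfolding circle_integrand_def split_beta
  using assms(2,3)
  by (intro continuous_intros continuous_on_compose2[OF assms(1)]) (auto simp: norm_mult)

text \<open>One radius serves all centres near \<open>z\<close>, so the contour stays fixed while
  the centre varies. Convexity of \<open>U\<close> is there for the Leibniz rule.\<close>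

lemma open_polydisc_radius:
  fixes z :: "complex^'n::finite"
  assumes "open S" "z \<in> S"
  obtains U r where "open U" "convex U" "z \<in> U" "r > 0"
    "\<And>y t. y \<in> U \<Longrightarrow> cmod t \<le> r \<Longrightarrow> y + t *s v \<in> S"
proof -
  obtain e where e: "e > 0" "ball z e \<subseteq> S" using assms openE by blast
  \<comment> \<open>The factor 2 leaves room \<open>e/2\<close> for moving the centre;
    \<open>+ 1\<close> keeps the denominator positive when \<open>v = 0\<close>.\<close>
  define r where "r = e / (2 * (norm v + 1))"
  have np: "norm v + 1 > 0" using norm_ge_zero[of v] by linarith
  have r: "r > 0" unfolding r_def using e np by simp
  have "r * norm v \<le> e/2" unfolding r_def using e(1) np by (simp add: field_simps)
  have "y + t *s v \<in> S" if "y \<in> ball z (e/2)" "cmod t \<le> r" for y t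
  proof -
    have "dist z (y + t *s v) \<le> dist z y + norm (t *s v)"
      by (metis add_diff_cancel_left' dist_commute dist_norm dist_triangle)
    also have "norm (t *s v) \<le> r * norm v" using that by (simp add: norm_smult_vec mult_right_mono)
    finally have "dist z (y + t *s v) < e" using that \<open>r * norm v \<le> e/2\<close> by simp
    then show ?thesis using e by auto
  qed
  then show ?thesis using that[of "ball z (e/2)" r] r e by auto
qed

text \<open>By Cauchy's formula the derivative is a parameter integral of the continuous function
  \<open>f\<close>. This continuity is not part of the definition of holomorphy, and differentiation
  under the integral sign relies on it.\<close>

lemma holomorphic_Cn_continuous_derivative:
  fixes f :: "complex^'n::finite \<Rightarrow> complex"
  assumes f: "holomorphic_Cn f S" and "open S"
  shows "continuous_on S (\<lambda>z. frechet_derivative f (at z) v)"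
proof (rule continuous_at_imp_continuous_on, rule ballI)
  fix z assume "z \<in> S"
  from open_polydisc_radius[OF \<open>open S\<close> this, of v] obtain U r where
    U: "open U" "z \<in> U" "r > 0" "\<And>y t. y \<in> U \<Longrightarrow> cmod t \<le> r \<Longrightarrow> y + t *s v \<in> S" by metis
  have "continuous_on U (\<lambda>z. integral (cbox 0 1) (circle_integrand r v f z))"
    by (intro integral_continuous_on_param continuous_on_circle_integrand[OF holomorphic_Cn_continuous_on[OF f]] U)
  then have "continuous_on U (\<lambda>z. frechet_derivative f (at z) v)"
    by (rule continuous_on_eq) (simp add: holomorphic_Cn_Cauchy[OF f U(3)] U)
  then show "isCont (\<lambda>z. frechet_derivative f (at z) v) z"
    using U continuous_on_eq_continuous_at by blast
qed

lemma continuous_on_section: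
  assumes "continuous_on (U \<times> T) (\<lambda>(x, t). f x t)" "y \<in> U"
  shows "continuous_on T (f y)"
proof -
  have "continuous_on T ((\<lambda>(x, t). f x t) \<circ> Pair y)"
    using assms(2)
    by (intro continuous_on_compose continuous_on_subset[OF assms(1)] continuous_intros) auto
  then show ?thesis by (simp add: o_def)
qed

text \<open>Cauchy's formula along the complex line through z in direction v may be differentiated under
  the integral sign.\<close>

lemma holomorphic_Cn_derivative_has_derivative:
  fixes f :: "complex^'n::finite \<Rightarrow> complex"
  assumes f: "holomorphic_Cn f S" and "open S" and "open U" "convex U" "z \<in> U" "r > 0"
    and US: "\<And>y t. y \<in> U \<Longrightarrow> cmod t \<le> r \<Longrightarrow> y + t *s v \<in> S"
  shows "((\<lambda>z. frechet_derivative f (at z) v) has_derivative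
      (\<lambda>h. integral {0..1} (circle_integrand r v (\<lambda>y. frechet_derivative f (at y) h) z))) (at z)"
proof -
  note cont = holomorphic_Cn_continuous_on[OF f]
  define c where "c t = r * cis (2 * pi * t)" for t
  have c: "c t \<noteq> 0" "cmod (c t) \<le> r" for t unfolding c_def using \<open>r > 0\<close> by (simp_all add: norm_mult)
  \<comment> \<open>The Leibniz rule wants the derivative of the integrand as a bounded operator
    that depends continuously on centre and parameter.\<close>
  define G where "G y t = Blinfun (\<lambda>h. circle_integrand r v (\<lambda>x. frechet_derivative f (at x) h) y t)" for y t
  have d: "((\<lambda>x. circle_integrand r v f x t) has_derivative
      (\<lambda>h. circle_integrand r v (\<lambda>x. frechet_derivative f (at x) h) y t)) (at y within U)" if "y \<in> U" for y t
  proof -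
    have "((\<lambda>x. f (x + c t *s v)) has_derivative (\<lambda>h. frechet_derivative f (at (y + c t *s v)) h)) (at y within U)"
      by (rule has_derivative_compose[where f="\<lambda>x. x + c t *s v" and f'="\<lambda>h. h"])
        (auto intro!: derivative_eq_intros holomorphic_Cn_has_derivative[OF f] US that c)
    then show ?thesis unfolding circle_integrand_def c_def[symmetric]
      unfolding divide_inverse by (rule has_derivative_mult_left)
  qed
  have G: "blinfun_apply (G y t) = (\<lambda>h. circle_integrand r v (\<lambda>x. frechet_derivative f (at x) h) y t)"
    if "y \<in> U" for y t
    unfolding G_def using d[OF that, of t] by (meson bounded_linear_Blinfun_apply has_derivative_bounded_linear)
  have contG: "continuous_on (U \<times> cbox 0 1) (\<lambda>(y, t). G y t)"
  \<comment> \<open>In finite dimension continuity in operator norm may be tested on each direction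
    \<open>h\<close>, where it reduces to continuity of the directional derivative of
    \<open>f\<close>.\<close>
  proof (rule continuous_on_blinfun_componentwise)
    fix h :: "complex^'n"
    have "continuous_on (U \<times> cbox 0 1) (\<lambda>(y, t). circle_integrand r v (\<lambda>x. frechet_derivative f (at x) h) y t)"
      by (intro continuous_on_circle_integrand[OF holomorphic_Cn_continuous_derivative[OF f \<open>open S\<close>]] US \<open>r > 0\<close>)
    then show "continuous_on (U \<times> cbox 0 1) (\<lambda>p. blinfun_apply (case p of (y, t) \<Rightarrow> G y t) h)"
      by (rule continuous_on_eq) (auto simp: G)
  qed
  have "continuous_on (cbox 0 1) (\<lambda>t. circle_integrand r v f y t)" if "y \<in> U" for y
    by (rule continuous_on_section[OF continuous_on_circle_integrand[OF cont \<open>r > 0\<close> US] that])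
  then have int: "circle_integrand r v f y integrable_on cbox 0 1" if "y \<in> U" for y
    using integrable_continuous that by metis
  have "((\<lambda>x. integral (cbox 0 1) (circle_integrand r v f x)) has_derivative integral (cbox 0 1) (G z)) (at z within U)"
  proof (rule leibniz_rule[OF _ _ contG \<open>z \<in> U\<close> \<open>convex U\<close>])
    fix y and t :: real
    assume "y \<in> U"
    show "((\<lambda>x. circle_integrand r v f x t) has_derivative blinfun_apply (G y t)) (at y within U)"
      unfolding G[OF \<open>y \<in> U\<close>] by (rule d[OF \<open>y \<in> U\<close>])
  qed (rule int)
  then have D: "((\<lambda>x. integral (cbox 0 1) (circle_integrand r v f x)) has_derivative integral (cbox 0 1) (G z)) (at z)"
    by (simp only: at_within_open[OF \<open>z \<in> U\<close> \<open>open U\<close>])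
  have F: "((\<lambda>z. frechet_derivative f (at z) v) has_derivative integral (cbox 0 1) (G z)) (at z)"
    by (rule has_derivative_transform_within_open[OF D \<open>open U\<close> \<open>z \<in> U\<close>])
      (simp add: holomorphic_Cn_Cauchy[OF f \<open>r > 0\<close> US])
  have *: "blinfun_apply (integral (cbox 0 1) (G z)) h =
     integral {0..1} (circle_integrand r v (\<lambda>y. frechet_derivative f (at y) h) z)" for h
  proof -
    have "continuous_on (cbox 0 1) (G z)"
      by (rule continuous_on_section[OF contG \<open>z \<in> U\<close>])
    then have "blinfun_apply (integral (cbox 0 1) (G z)) h = integral (cbox 0 1) (\<lambda>t. blinfun_apply (G z t) h)"
      by (intro blinfun_apply_integral integrable_continuous)
    then show ?thesis by (simp add: G[OF \<open>z \<in> U\<close>])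
  qed
  have "blinfun_apply (integral (cbox 0 1) (G z)) =
      (\<lambda>h. integral {0..1} (circle_integrand r v (\<lambda>y. frechet_derivative f (at y) h) z))"
    by (rule ext) (rule *)
  then show ?thesis using F by (simp only:)
qed

text \<open>The integral that represents the derivative of the \<open>v\<close>-derivative is
  complex linear in the direction because its integrand is. Directional derivatives are therefore
  holomorphic again, and the process can be iterated.\<close>

theorem holomorphic_Cn_derivative:
  fixes f :: "complex^'n::finite \<Rightarrow> complex"
  assumes f: "holomorphic_Cn f S" and "open S"
  shows "holomorphic_Cn (\<lambda>z. frechet_derivative f (at z) v) S"
  unfolding holomorphic_Cn_def
proof
  fix z assume "z \<in> S"
  from open_polydisc_radius[OF \<open>open S\<close> this, of v] obtain U r where
    U: "open U" "convex U" "z \<in> U" "r > 0" "\<And>y t. y \<in> U \<Longrightarrow> cmod t \<le> r \<Longrightarrow> y + t *s v \<in> S" by metis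
  define L where "L h = integral {0..1} (circle_integrand r v (\<lambda>y. frechet_derivative f (at y) h) z)" for h
  have "((\<lambda>z. frechet_derivative f (at z) v) has_derivative L) (at z)"
    unfolding L_def by (rule holomorphic_Cn_derivative_has_derivative[OF f \<open>open S\<close> U])
  moreover have "L (a *s h) = a * L h" for a h
  proof -
    have "circle_integrand r v (\<lambda>y. frechet_derivative f (at y) (a *s h)) z t
        = a * circle_integrand r v (\<lambda>y. frechet_derivative f (at y) h) z t" for t
      unfolding circle_integrand_def using U
      by (subst holomorphic_Cn_derivative_scale[OF f]) (auto simp: norm_mult)
    then have "circle_integrand r v (\<lambda>y. frechet_derivative f (at y) (a *s h)) z
        = (\<lambda>t. a * circle_integrand r v (\<lambda>y. frechet_derivative f (at y) h) z t)" by blast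
    then show ?thesis unfolding L_def by simp
  qed
  ultimately show "\<exists>f'. ((\<lambda>z. frechet_derivative f (at z) v) has_derivative f') (at z) \<and>
      (\<forall>a v. f' (a *s v) = a * f' v)" by blast
qed

text \<open>Both sides are the same integral: Cauchy's formula for the \<open>v\<close>-derivative
  of \<open>f\<close>, differentiated under the integral in direction \<open>u\<close>, is Cauchy's
  formula for the \<open>v\<close>-derivative of the \<open>u\<close>-derivative.\<close>

theorem holomorphic_Cn_second_derivative_symmetric:
  fixes f :: "complex^'n::finite \<Rightarrow> complex"
  assumes f: "holomorphic_Cn f S" and "open S" "z \<in> S"
  shows "frechet_derivative (\<lambda>z. frechet_derivative f (at z) v) (at z) u =
    frechet_derivative (\<lambda>z. frechet_derivative f (at z) u) (at z) v"
proof -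
  from open_polydisc_radius[OF \<open>open S\<close> \<open>z \<in> S\<close>, of v] obtain U r where
    U: "open U" "convex U" "z \<in> U" "r > 0" "\<And>y t. y \<in> U \<Longrightarrow> cmod t \<le> r \<Longrightarrow> y + t *s v \<in> S" by metis
  have "frechet_derivative (\<lambda>z. frechet_derivative f (at z) v) (at z) =
      (\<lambda>h. integral {0..1} (circle_integrand r v (\<lambda>y. frechet_derivative f (at y) h) z))"
    by (rule frechet_derivative_at[symmetric, OF holomorphic_Cn_derivative_has_derivative[OF f \<open>open S\<close> U]])
  moreover have "frechet_derivative (\<lambda>z. frechet_derivative f (at z) u) (at z) v
      = integral {0..1} (circle_integrand r v (\<lambda>y. frechet_derivative f (at y) u) z)"
    by (rule holomorphic_Cn_Cauchy[OF holomorphic_Cn_derivative[OF f \<open>open S\<close>] U(4) U(5)[OF U(3)]])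
  ultimately show ?thesis by simp
qed

section \<open>Calculus in charts\<close>

lemma has_derivative_vecI:
  fixes f :: "'a::euclidean_space \<Rightarrow> complex^'n::finite"
  assumes "\<And>i. ((\<lambda>z. f z $ i) has_derivative (\<lambda>h. D h $ i)) (at z within S)"
  shows "(f has_derivative D) (at z within S)"
proof (subst has_derivative_componentwise_within, rule ballI)
  fix b :: "complex^'n" assume "b \<in> Basis"
  then obtain i c where b: "b = axis i c" by (auto simp: Basis_vec_def)
  show "((\<lambda>x. f x \<bullet> b) has_derivative (\<lambda>x. D x \<bullet> b)) (at z within S)"
    unfolding b inner_axis by (rule has_derivative_inner_left[OF assms])
qed

lemma vec_expansion: "(v::complex^'n::finite) = (\<Sum>k\<in>UNIV. (v $ k) *s axis k 1)"
  by (simp add: basis_expansion)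

text \<open>Refers to a single chart \<open>c\<close>, unlike \<open>hol_fun\<close>: the components
  of a form depend on the chart, and each is first of all holomorphic in its own.\<close>

definition chart_holomorphic :: "('x,'c,'n::finite) atlas \<Rightarrow> 'c \<Rightarrow> 'x set \<Rightarrow> ('x \<Rightarrow> complex) \<Rightarrow> bool" where
  "chart_holomorphic X c V f \<longleftrightarrow>
     holomorphic_Cn (\<lambda>z. f (chart_inv X c z)) (chart_map X c ` (chart_dom X c \<inter> V))"

locale complex_mfd =
  fixes X :: "('x::t2_space, 'c, 'n::finite) atlas"
  assumes complex_manifold: "complex_manifold X"
begin

lemma open_chart_dom: "open (chart_dom X c)"
  using complex_manifold unfolding complex_manifold_def by blast

lemma chart_homeomorphism:
  "homeomorphism (chart_dom X c) (chart_map X c ` chart_dom X c) (chart_map X c) (chart_inv X c)"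
  using complex_manifold unfolding complex_manifold_def by blast

lemma chart_inv_map: "x \<in> chart_dom X c \<Longrightarrow> chart_inv X c (chart_map X c x) = x"
  using chart_homeomorphism by (meson homeomorphism_apply1)

lemma chart_covers: "\<exists>c. x \<in> chart_dom X c"
  using complex_manifold unfolding complex_manifold_def by blast

lemma open_chart_image:
  assumes "open V"
  shows "open (chart_map X c ` (chart_dom X c \<inter> V))"
proof -
  have "openin (top_of_set (chart_dom X c)) (chart_dom X c \<inter> V)"
    using assms by (simp add: openin_open_Int)
  then have "openin (top_of_set (chart_map X c ` chart_dom X c)) (chart_map X c ` (chart_dom X c \<inter> V))"
    by (rule homeomorphism_imp_open_map[OF chart_homeomorphism])
  moreover have "open (chart_map X c ` chart_dom X c)"
    using complex_manifold unfolding complex_manifold_def by blast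
  ultimately show ?thesis by (rule openin_open_trans)
qed

lemma chart_deriv_cong:
  assumes "open V" "x \<in> chart_dom X c \<inter> V" "\<And>y. y \<in> chart_dom X c \<inter> V \<Longrightarrow> f y = g y"
  shows "chart_deriv X c f x = chart_deriv X c g x"
proof -
  have "frechet_derivative (\<lambda>z. f (chart_inv X c z)) (at (chart_map X c x))
    = frechet_derivative (\<lambda>z. g (chart_inv X c z)) (at (chart_map X c x))"
    by (rule frechet_derivative_cong_open[OF open_chart_image[OF assms(1)]])
      (use assms(2,3) in \<open>auto simp: chart_inv_map\<close>)
  then show ?thesis unfolding chart_deriv_def by (simp add: fun_eq_iff)
qed

lemma chart_holomorphic_cong:
  assumes "open V" "\<And>y. y \<in> chart_dom X c \<inter> V \<Longrightarrow> f y = g y" "chart_holomorphic X c V f"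
  shows "chart_holomorphic X c V g"
  using assms(3) unfolding chart_holomorphic_def
  by (rule holomorphic_Cn_cong[OF open_chart_image[OF assms(1)], rotated])
    (use assms(2) in \<open>auto simp: chart_inv_map\<close>)

lemma chart_holomorphic_subset:
  assumes "chart_holomorphic X c V f" "W \<subseteq> V"
  shows "chart_holomorphic X c W f"
  using assms(1) unfolding chart_holomorphic_def
  by (rule holomorphic_Cn_subset) (use assms(2) in auto)

lemma chart_holomorphic_const: "chart_holomorphic X c V (\<lambda>y. a)"
  unfolding chart_holomorphic_def by (rule holomorphic_Cn_const)

lemma chart_holomorphic_add:
  "chart_holomorphic X c V f \<Longrightarrow> chart_holomorphic X c V g \<Longrightarrow> chart_holomorphic X c V (\<lambda>y. f y + g y)"
  unfolding chart_holomorphic_def by (rule holomorphic_Cn_add)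

lemma chart_holomorphic_mult:
  "chart_holomorphic X c V f \<Longrightarrow> chart_holomorphic X c V g \<Longrightarrow> chart_holomorphic X c V (\<lambda>y. f y * g y)"
  unfolding chart_holomorphic_def by (rule holomorphic_Cn_mult)

lemma chart_holomorphic_has_derivative:
  assumes "chart_holomorphic X c V f" "x \<in> chart_dom X c \<inter> V"
  shows "((\<lambda>z. f (chart_inv X c z)) has_derivative chart_deriv X c f x) (at (chart_map X c x))"
proof -
  have "chart_deriv X c f x = frechet_derivative (\<lambda>z. f (chart_inv X c z)) (at (chart_map X c x))"
    by (rule ext) (simp add: chart_deriv_def)
  then show ?thesis
    using holomorphic_Cn_has_derivative[OF assms(1)[unfolded chart_holomorphic_def], of "chart_map X c x"] assms(2)
    by simp
qed

lemma chart_deriv_unique: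
  assumes "((\<lambda>z. f (chart_inv X c z)) has_derivative D) (at (chart_map X c x))"
  shows "chart_deriv X c f x v = D v"
  unfolding chart_deriv_def using frechet_derivative_at[OF assms] by simp

lemma chart_deriv_const: "chart_deriv X c (\<lambda>y. a) x v = 0"
  by (rule chart_deriv_unique[of _ _ "\<lambda>_. 0", simplified]) simp

lemma chart_deriv_add:
  assumes "chart_holomorphic X c V f" "chart_holomorphic X c V g" "x \<in> chart_dom X c \<inter> V"
  shows "chart_deriv X c (\<lambda>y. f y + g y) x v = chart_deriv X c f x v + chart_deriv X c g x v"
  by (rule chart_deriv_unique)
    (rule has_derivative_add[OF chart_holomorphic_has_derivative[OF assms(1,3)]
        chart_holomorphic_has_derivative[OF assms(2,3)]])

lemma chart_deriv_mult:
  assumes "chart_holomorphic X c V f" "chart_holomorphic X c V g" "x \<in> chart_dom X c \<inter> V"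
  shows "chart_deriv X c (\<lambda>y. f y * g y) x v = f x * chart_deriv X c g x v + chart_deriv X c f x v * g x"
proof -
  have "((\<lambda>z. f (chart_inv X c z) * g (chart_inv X c z)) has_derivative
     (\<lambda>v. f x * chart_deriv X c g x v + chart_deriv X c f x v * g x)) (at (chart_map X c x))"
    using has_derivative_mult[OF chart_holomorphic_has_derivative[OF assms(1,3)]
        chart_holomorphic_has_derivative[OF assms(2,3)]] assms(3) by (simp add: chart_inv_map)
  then show ?thesis by (rule chart_deriv_unique)
qed

lemma chart_deriv_scale:
  assumes "chart_holomorphic X c V f" "x \<in> chart_dom X c \<inter> V"
  shows "chart_deriv X c (\<lambda>y. a * f y) x v = a * chart_deriv X c f x v"
  using chart_deriv_mult[OF chart_holomorphic_const assms, of a v] by (simp add: chart_deriv_const)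

lemma chart_deriv_sum:
  assumes "\<And>i. i \<in> I \<Longrightarrow> chart_holomorphic X c V (f i)" "x \<in> chart_dom X c \<inter> V"
  shows "chart_deriv X c (\<lambda>y. \<Sum>i\<in>I. f i y) x v = (\<Sum>i\<in>I. chart_deriv X c (f i) x v)"
  by (rule chart_deriv_unique)
    (rule has_derivative_sum[OF chart_holomorphic_has_derivative[OF assms(1) assms(2)]])

lemma chart_deriv_linear:
  assumes "chart_holomorphic X c V f" "x \<in> chart_dom X c \<inter> V"
  shows "chart_deriv X c f x (a *s u + b *s w) = a * chart_deriv X c f x u + b * chart_deriv X c f x w"
proof -
  have "chart_map X c x \<in> chart_map X c ` (chart_dom X c \<inter> V)" using assms(2) by blast
  note * = holomorphic_Cn_derivative_add[OF assms(1)[unfolded chart_holomorphic_def] this]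
    holomorphic_Cn_derivative_scale[OF assms(1)[unfolded chart_holomorphic_def] this]
  show ?thesis unfolding chart_deriv_def by (simp add: *)
qed

lemma chart_deriv_chart_inv:
  assumes "z \<in> chart_map X c ` (chart_dom X c \<inter> V)"
  shows "chart_deriv X c f (chart_inv X c z) v = frechet_derivative (\<lambda>z. f (chart_inv X c z)) (at z) v"
  using assms unfolding chart_deriv_def by (auto simp: chart_inv_map)

lemma chart_holomorphic_deriv:
  assumes "chart_holomorphic X c V f" "open V"
  shows "chart_holomorphic X c V (\<lambda>y. chart_deriv X c f y v)"
  unfolding chart_holomorphic_def
  by (rule holomorphic_Cn_cong[OF open_chart_image[OF assms(2)] _
        holomorphic_Cn_derivative[OF assms(1)[unfolded chart_holomorphic_def] open_chart_image[OF assms(2)]]])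
    (rule chart_deriv_chart_inv[symmetric])

text \<open>This is dd = 0 in coordinates. It produces the cancellations in the coordinate change of
  the exterior derivative, in the gauge change of connection forms, and in the curvature of a
  section.\<close>

lemma chart_deriv_symmetric:
  assumes "chart_holomorphic X c V f" "open V" "x \<in> chart_dom X c \<inter> V"
  shows "chart_deriv X c (\<lambda>y. chart_deriv X c f y v) x u = chart_deriv X c (\<lambda>y. chart_deriv X c f y u) x v"
proof -
  let ?S = "chart_map X c ` (chart_dom X c \<inter> V)"
  let ?f = "\<lambda>z. f (chart_inv X c z)"
  have x: "chart_map X c x \<in> ?S" using assms(3) by blast
  have S: "open ?S" by (rule open_chart_image[OF assms(2)])
  have *: "chart_deriv X c (\<lambda>y. chart_deriv X c f y v) x u =
      frechet_derivative (\<lambda>z. frechet_derivative ?f (at z) v) (at (chart_map X c x)) u" for u v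
    unfolding chart_deriv_def[of X c "\<lambda>y. chart_deriv X c f y v"]
    by (subst frechet_derivative_cong_open[OF S x chart_deriv_chart_inv]) auto
  show ?thesis unfolding *
    by (rule holomorphic_Cn_second_derivative_symmetric[OF assms(1)[unfolded chart_holomorphic_def] S x])
qed

lemma chart_holomorphic_transition: "chart_holomorphic X c (chart_dom X d) (\<lambda>y. chart_map X d y $ i)"
  using complex_manifold unfolding complex_manifold_def chart_holomorphic_def by blast

text \<open>Holomorphy of the coordinate change is given by components, whereas
  \<open>chart_jac\<close> differentiates the vector-valued map; the derivative is assembled from
  the components and then identified by uniqueness.\<close>

lemma chart_jac_has_derivative:
  assumes "x \<in> chart_dom X c \<inter> chart_dom X d"
  shows "((\<lambda>z. chart_map X d (chart_inv X c z)) has_derivative chart_jac X c d x) (at (chart_map X c x))"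
    and "chart_jac X c d x v $ i = chart_deriv X c (\<lambda>y. chart_map X d y $ i) x v"
proof -
  define J where "J v = (\<chi> i. chart_deriv X c (\<lambda>y. chart_map X d y $ i) x v)" for v
  have J: "((\<lambda>z. chart_map X d (chart_inv X c z)) has_derivative J) (at (chart_map X c x))"
    by (rule has_derivative_vecI)
      (simp add: J_def chart_holomorphic_has_derivative[OF chart_holomorphic_transition assms])
  have "chart_jac X c d x = J"
    unfolding chart_jac_def by (rule ext) (rule chart_deriv_unique[OF J])
  with J show "((\<lambda>z. chart_map X d (chart_inv X c z)) has_derivative chart_jac X c d x) (at (chart_map X c x))"
    "chart_jac X c d x v $ i = chart_deriv X c (\<lambda>y. chart_map X d y $ i) x v"
    by (simp_all add: J_def)
qed

lemma chart_change_has_derivative: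
  assumes f: "chart_holomorphic X d V f" and "open V" and x: "x \<in> chart_dom X c \<inter> chart_dom X d \<inter> V"
  shows "((\<lambda>z. f (chart_inv X c z)) has_derivative
      (\<lambda>v. chart_deriv X d f x (chart_jac X c d x v))) (at (chart_map X c x))"
proof -
  have cd: "x \<in> chart_dom X c \<inter> chart_dom X d" using x by blast
  have e: "chart_map X d (chart_inv X c (chart_map X c x)) = chart_map X d x"
    using x by (simp add: chart_inv_map)
  have "((\<lambda>z. f (chart_inv X d (chart_map X d (chart_inv X c z)))) has_derivative
      (\<lambda>v. chart_deriv X d f x (chart_jac X c d x v))) (at (chart_map X c x))"
    by (rule has_derivative_compose[OF chart_jac_has_derivative(1)[OF cd]], unfold e)
      (rule chart_holomorphic_has_derivative[OF f], use x in blast)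
  then show ?thesis
    \<comment> \<open>The detour through chart \<open>d\<close> is the identity only over the
      overlap, whose image in chart \<open>c\<close> is open.\<close>
    by (rule has_derivative_transform_within_open[OF _ open_chart_image[OF open_chart_dom[of d], of c]])
      (use x in \<open>auto simp: chart_inv_map\<close>)
qed

lemma chart_deriv_chain:
  assumes "chart_holomorphic X d V f" "open V" "x \<in> chart_dom X c \<inter> chart_dom X d \<inter> V"
  shows "chart_deriv X c f x v = chart_deriv X d f x (chart_jac X c d x v)"
  by (rule chart_deriv_unique[OF chart_change_has_derivative[OF assms]])

end

section \<open>Holomorphic forms and the exterior derivative\<close>

lemma length_2_cases: "length vs = 2 \<Longrightarrow> \<exists>u w. vs = [u, w]"
  by (auto simp: numeral_2_eq_2 length_Suc_conv)

lemma
  assumes "\<alpha> \<in> hol_form X k V"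
  shows hol_form_zero: "x \<notin> chart_dom X c \<inter> V \<or> length vs \<noteq> k \<Longrightarrow> \<alpha> c x vs = 0"
    and hol_form_linear: "x \<in> chart_dom X c \<inter> V \<Longrightarrow> length vs = k \<Longrightarrow> i < k \<Longrightarrow>
        \<alpha> c x (vs[i := a *s u + b *s w]) = a * \<alpha> c x (vs[i := u]) + b * \<alpha> c x (vs[i := w])"
    and hol_form_transform: "x \<in> chart_dom X c \<inter> chart_dom X d \<inter> V \<Longrightarrow>
        \<alpha> c x vs = \<alpha> d x (map (chart_jac X c d x) vs)"
    and hol_form_holomorphic: "chart_holomorphic X c V (\<lambda>x. \<alpha> c x vs)"
  using assms unfolding hol_form_def chart_holomorphic_def by simp_all

lemma hol_form_alternating:
  assumes "\<alpha> \<in> hol_form X k V" "x \<in> chart_dom X c \<inter> V" "length vs = k" "i < j" "j < k" "vs ! i = vs ! j"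
  shows "\<alpha> c x vs = 0"
proof -
  have "\<forall>c x vs i j. x \<in> chart_dom X c \<inter> V \<and> length vs = k \<and> i < j \<and> j < k \<and> vs ! i = vs ! j \<longrightarrow>
    \<alpha> c x vs = 0"
    using assms(1) unfolding hol_form_def mem_Collect_eq by (elim conjE)
  then show ?thesis using assms(2-) by blast
qed

text \<open>Transformation and holomorphy are demanded only for lists of length \<open>k\<close>:
  for other lengths they follow from the vanishing, as \<open>map\<close> preserves the
  length.\<close>

lemma hol_formI:
  assumes "\<And>c x vs. x \<notin> chart_dom X c \<inter> V \<or> length vs \<noteq> k \<Longrightarrow> \<alpha> c x vs = 0"
    and "\<And>c x vs i u w a b. x \<in> chart_dom X c \<inter> V \<Longrightarrow> length vs = k \<Longrightarrow> i < k \<Longrightarrow>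
        \<alpha> c x (vs[i := a *s u + b *s w]) = a * \<alpha> c x (vs[i := u]) + b * \<alpha> c x (vs[i := w])"
    and "\<And>c x vs i j. x \<in> chart_dom X c \<inter> V \<Longrightarrow> length vs = k \<Longrightarrow> i < j \<Longrightarrow> j < k \<Longrightarrow> vs ! i = vs ! j \<Longrightarrow>
        \<alpha> c x vs = 0"
    and "\<And>c d x vs. x \<in> chart_dom X c \<inter> chart_dom X d \<inter> V \<Longrightarrow> length vs = k \<Longrightarrow>
        \<alpha> c x vs = \<alpha> d x (map (chart_jac X c d x) vs)"
    and "\<And>c vs. length vs = k \<Longrightarrow> chart_holomorphic X c V (\<lambda>x. \<alpha> c x vs)"
  shows "\<alpha> \<in> hol_form X k V"
proof -
  have "\<alpha> c x vs = \<alpha> d x (map (chart_jac X c d x) vs)"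
    if "x \<in> chart_dom X c \<inter> chart_dom X d \<inter> V" for c d x vs
    using assms(1)[of x c vs] assms(1)[of x d "map (chart_jac X c d x) vs"] assms(4)[OF that]
    by (cases "length vs = k") auto
  moreover have "holomorphic_Cn (\<lambda>z. \<alpha> c (chart_inv X c z) vs) (chart_map X c ` (chart_dom X c \<inter> V))" for c vs
  proof (cases "length vs = k")
    case True
    then show ?thesis using assms(5)[of vs c] by (simp add: chart_holomorphic_def)
  next
    case False
    then have "(\<lambda>z. \<alpha> c (chart_inv X c z) vs) = (\<lambda>z. 0)" using assms(1) by blast
    then show ?thesis by (simp only: holomorphic_Cn_const)
  qed
  ultimately show ?thesis
    unfolding hol_form_def mem_Collect_eq using assms(1-3) by blast
qed

lemma hol_form1_linear:
  assumes "\<alpha> \<in> hol_form X 1 V" "x \<in> chart_dom X c \<inter> V"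
  shows "\<alpha> c x [a *s u + b *s w] = a * \<alpha> c x [u] + b * \<alpha> c x [w]"
  using hol_form_linear[OF assms, of "[u]" 0 a u b w] by simp

lemma hol_form1_sum:
  assumes "\<alpha> \<in> hol_form X 1 V" "x \<in> chart_dom X c \<inter> V"
  shows "\<alpha> c x [\<Sum>k\<in>I. a k *s u k] = (\<Sum>k\<in>I. a k * \<alpha> c x [u k])"
proof (induction I rule: infinite_finite_induct)
  case (insert k I)
  then show ?case
    using hol_form1_linear[OF assms, of "a k" "u k" 1 "\<Sum>k\<in>I. a k *s u k"] by simp
qed (use hol_form1_linear[OF assms, of 0 0 0 0] in simp_all)

lemma hol_form1_expand:
  assumes "\<alpha> \<in> hol_form X 1 V" "x \<in> chart_dom X c \<inter> V"
  shows "\<alpha> c x [v] = (\<Sum>k\<in>UNIV. v $ k * \<alpha> c x [axis k 1])"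
  using hol_form1_sum[OF assms, of "\<lambda>k. v $ k" "\<lambda>k. axis k 1" UNIV] vec_expansion[of v] by simp

lemma hol_form_scale:
  assumes "\<alpha> \<in> hol_form X k V"
  shows "(\<lambda>c x vs. a * \<alpha> c x vs) \<in> hol_form X k V"
proof (rule hol_formI)
  fix c d x vs assume x: "x \<in> chart_dom X c \<inter> chart_dom X d \<inter> V"
  show "a * \<alpha> c x vs = a * \<alpha> d x (map (chart_jac X c d x) vs)"
    using hol_form_transform[OF assms x, of vs] by simp
next
  fix c vs show "chart_holomorphic X c V (\<lambda>x. a * \<alpha> c x vs)"
    using holomorphic_Cn_mult[OF holomorphic_Cn_const, of "\<lambda>z. \<alpha> c (chart_inv X c z) vs" _ a]
      hol_form_holomorphic[OF assms, of c vs] unfolding chart_holomorphic_def by blast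
qed (simp_all add: hol_form_zero[OF assms] hol_form_linear[OF assms] hol_form_alternating[OF assms] algebra_simps)

lemma remove_nth_simps:
  "remove_nth 0 (v # vs) = vs" "remove_nth (Suc j) (v # vs) = v # remove_nth j vs"
  by (simp_all add: remove_nth_def)

lemma length_remove_nth: "j < length vs \<Longrightarrow> length (remove_nth j vs) = length vs - 1"
  by (simp add: remove_nth_def)

lemma wedge1_pair: "wedge1 \<alpha> \<beta> c x [u, v] = \<alpha> c x [u] * \<beta> c x [v] - \<alpha> c x [v] * \<beta> c x [u]"
  by (simp add: wedge1_def remove_nth_simps lessThan_Suc numeral_2_eq_2)

lemma wedge1_zero:
  assumes "\<And>vs. length vs \<noteq> 1 \<Longrightarrow> \<beta> c x vs = 0" "length vs \<noteq> 2"
  shows "wedge1 \<alpha> \<beta> c x vs = 0"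
  unfolding wedge1_def using assms(2)
  by (intro sum.neutral ballI) (simp add: assms(1) length_remove_nth)

context complex_mfd
begin

lemma ext_deriv_pair:
  assumes "x \<in> chart_dom X c \<inter> V"
  shows "ext_deriv X V \<alpha> c x [u, v] =
    chart_deriv X c (\<lambda>y. \<alpha> c y [v]) x u - chart_deriv X c (\<lambda>y. \<alpha> c y [u]) x v"
  using assms by (simp add: ext_deriv_def remove_nth_simps lessThan_Suc numeral_2_eq_2)

lemma ext_deriv_zero:
  assumes "\<And>y vs. length vs \<noteq> 1 \<Longrightarrow> \<alpha> c y vs = 0" "x \<notin> chart_dom X c \<inter> V \<or> length vs \<noteq> 2"
  shows "ext_deriv X V \<alpha> c x vs = 0"
proof (cases "x \<in> chart_dom X c \<inter> V")
  case True
  have "(\<lambda>y. \<alpha> c y (remove_nth j vs)) = (\<lambda>y. 0)" if "j < length vs" for j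
    using assms True that by (intro ext assms(1)) (simp add: length_remove_nth)
  then show ?thesis
    unfolding ext_deriv_def by (auto intro!: sum.neutral simp: chart_deriv_const)
next
  case False
  then show ?thesis by (simp only: ext_deriv_def if_False)
qed

lemma ext_deriv_fun:
  assumes "x \<in> chart_dom X c \<inter> V"
  shows "ext_deriv X V (form_of_fun X f) c x [v] = chart_deriv X c f x v"
proof -
  have "chart_deriv X c (\<lambda>y. form_of_fun X f c y []) x = chart_deriv X c f x"
    by (rule chart_deriv_cong[of UNIV]) (use assms in \<open>auto simp: form_of_fun_def\<close>)
  then show ?thesis using assms by (simp add: ext_deriv_def remove_nth_simps)
qed

text \<open>The sheaf property: each clause of \<open>hol_form\<close> concerns a point or a
  neighbourhood of it. It allows the curvature to be glued from the trivialising sets.\<close>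

lemma hol_form_local:
  assumes "\<And>x. \<exists>W \<beta>. open W \<and> x \<in> W \<and> \<beta> \<in> hol_form X k W \<and> (\<forall>y\<in>W. \<forall>c vs. \<alpha> c y vs = \<beta> c y vs)"
  shows "\<alpha> \<in> hol_form X k UNIV"
proof -
  obtain W \<beta> where W: "\<And>x. open (W x)" "\<And>x. x \<in> W x" "\<And>x. \<beta> x \<in> hol_form X k (W x)"
    and eq: "\<And>x y c vs. y \<in> W x \<Longrightarrow> \<alpha> c y vs = \<beta> x c y vs"
    using assms by metis
  show ?thesis
  proof (rule hol_formI)
    fix c and vs :: "(complex^'n) list"
    show "chart_holomorphic X c UNIV (\<lambda>x. \<alpha> c x vs)"
      unfolding chart_holomorphic_def holomorphic_Cn_def
    proof
      fix z assume "z \<in> chart_map X c ` (chart_dom X c \<inter> UNIV)"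
      then obtain x where x: "x \<in> chart_dom X c" "z = chart_map X c x" by auto
      have "chart_holomorphic X c (W x) (\<lambda>y. \<alpha> c y vs)"
        by (rule chart_holomorphic_cong[OF W(1) _ hol_form_holomorphic[OF W(3), of c x vs]]) (rule eq[symmetric], blast)
      then show "\<exists>f'. ((\<lambda>z. \<alpha> c (chart_inv X c z) vs) has_derivative f') (at z) \<and> (\<forall>a v. f' (a *s v) = a * f' v)"
        unfolding chart_holomorphic_def holomorphic_Cn_def using x W(2) by blast
    qed
  next
    fix c x and vs :: "(complex^'n) list" assume "x \<notin> chart_dom X c \<inter> UNIV \<or> length vs \<noteq> k"
    then show "\<alpha> c x vs = 0" unfolding eq[OF W(2)] by (intro hol_form_zero[OF W(3)]) auto
  next
    fix c x i u w a b and vs :: "(complex^'n) list"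
    assume "x \<in> chart_dom X c \<inter> UNIV" "length vs = k" "i < k"
    then show "\<alpha> c x (vs[i := a *s u + b *s w]) = a * \<alpha> c x (vs[i := u]) + b * \<alpha> c x (vs[i := w])"
      unfolding eq[OF W(2)] by (intro hol_form_linear[OF W(3)]) (auto simp: W(2))
  next
    fix c x and i j :: nat and vs :: "(complex^'n) list"
    assume "x \<in> chart_dom X c \<inter> UNIV" "length vs = k" "i < j" "j < k" "vs ! i = vs ! j"
    then show "\<alpha> c x vs = 0"
      unfolding eq[OF W(2)] by (intro hol_form_alternating[OF W(3), where i=i and j=j]) (auto simp: W(2))
  next
    fix c d x and vs :: "(complex^'n) list" assume "x \<in> chart_dom X c \<inter> chart_dom X d \<inter> UNIV"
    then show "\<alpha> c x vs = \<alpha> d x (map (chart_jac X c d x) vs)"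
      unfolding eq[OF W(2)] by (intro hol_form_transform[OF W(3)]) (auto simp: W(2))
  qed
qed

lemma chart_jac_linear:
  assumes "x \<in> chart_dom X c \<inter> chart_dom X d"
  shows "chart_jac X c d x (a *s u + b *s w) = a *s chart_jac X c d x u + b *s chart_jac X c d x w"
  unfolding vec_eq_iff
  by (simp add: chart_jac_has_derivative(2)[OF assms] chart_deriv_linear[OF chart_holomorphic_transition assms])

text \<open>For a fixed function holomorphy does not depend on the chart: the chain rule composes
  its derivative with a complex linear Jacobian. It permits differentiating the components with
  respect to chart \<open>d\<close> in chart \<open>c\<close>.\<close>

lemma chart_holomorphic_change:
  assumes f: "chart_holomorphic X d V f" and "open V"
  shows "chart_holomorphic X c (chart_dom X d \<inter> V) f"
  unfolding chart_holomorphic_def holomorphic_Cn_def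
proof
  fix z assume "z \<in> chart_map X c ` (chart_dom X c \<inter> (chart_dom X d \<inter> V))"
  then obtain x where z: "z = chart_map X c x" and x: "x \<in> chart_dom X c \<inter> chart_dom X d \<inter> V" by blast
  have x': "x \<in> chart_dom X d \<inter> V" "x \<in> chart_dom X c \<inter> chart_dom X d" using x by auto
  have "chart_deriv X d f x (chart_jac X c d x (a *s v)) = a * chart_deriv X d f x (chart_jac X c d x v)" for a v
    using chart_jac_linear[OF x'(2), of a v 0 0]
      chart_deriv_linear[OF f x'(1), of a "chart_jac X c d x v" 0 0] by simp
  then show "\<exists>f'. ((\<lambda>z. f (chart_inv X c z)) has_derivative f') (at z) \<and> (\<forall>a v. f' (a *s v) = a * f' v)"
    unfolding z using chart_change_has_derivative[OF f \<open>open V\<close> x] by blast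
qed

text \<open>The second derivatives of the coordinate change enter symmetrically and cancel.\<close>

lemma ext_deriv_transform:
  assumes \<alpha>: "\<alpha> \<in> hol_form X 1 V" and V: "open V" and x: "x \<in> chart_dom X c \<inter> chart_dom X d \<inter> V"
  shows "ext_deriv X V \<alpha> c x [u, v] = ext_deriv X V \<alpha> d x [chart_jac X c d x u, chart_jac X c d x v]"
proof -
  define W where "W = chart_dom X d \<inter> V"
  have W: "open W" and xW: "x \<in> chart_dom X c \<inter> W" and xcd: "x \<in> chart_dom X c \<inter> chart_dom X d"
    and xd: "x \<in> chart_dom X d \<inter> V" and xc: "x \<in> chart_dom X c \<inter> V"
    unfolding W_def using open_chart_dom V x by auto
  \<comment> \<open>The components of \<alpha> in chart \<open>d\<close>; with the Jacobian entries
    \<open>t\<close> below, the value of \<alpha> in chart \<open>c\<close> on \<open>w\<close> is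
    the sum over \<open>k\<close> of \<open>t w k * b k\<close>.\<close>
  define b where "b k y = \<alpha> d y [axis k 1]" for k y
  define t where "t w k y = chart_deriv X c (\<lambda>y. chart_map X d y $ k) y w" for w k y
  have hb: "chart_holomorphic X d V (b k)" for k
    unfolding b_def by (rule hol_form_holomorphic[OF \<alpha>])
  have hbc: "chart_holomorphic X c W (b k)" for k
    unfolding W_def by (rule chart_holomorphic_change[OF hb V])
  have ht: "chart_holomorphic X c W (t w k)" for w k
    unfolding t_def W_def
    by (rule chart_holomorphic_subset[OF chart_holomorphic_deriv[OF chart_holomorphic_transition open_chart_dom]]) simp
  have t: "chart_jac X c d x w $ k = t w k x" for w k
    unfolding t_def by (rule chart_jac_has_derivative(2)[OF xcd])
  have c1: "chart_deriv X c (\<lambda>y. \<alpha> c y [w]) x w' =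
     (\<Sum>k\<in>UNIV. t w k x * chart_deriv X d (b k) x (chart_jac X c d x w') + chart_deriv X c (t w k) x w' * b k x)"
    for w w'
  proof -
    have "\<alpha> c y [w] = (\<Sum>k\<in>UNIV. t w k y * b k y)" if "y \<in> chart_dom X c \<inter> W" for y
    proof -
      have y: "y \<in> chart_dom X c \<inter> chart_dom X d \<inter> V" "y \<in> chart_dom X d \<inter> V" "y \<in> chart_dom X c \<inter> chart_dom X d"
        using that unfolding W_def by auto
      have "\<alpha> c y [w] = \<alpha> d y [chart_jac X c d y w]"
        using hol_form_transform[OF \<alpha> y(1), of "[w]"] by simp
      then show ?thesis
        by (simp add: hol_form1_expand[OF \<alpha> y(2), of "chart_jac X c d y w"] chart_jac_has_derivative(2)[OF y(3)] t_def b_def)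
    qed
    from chart_deriv_cong[OF W xW this]
    have "chart_deriv X c (\<lambda>y. \<alpha> c y [w]) x w' = chart_deriv X c (\<lambda>y. \<Sum>k\<in>UNIV. t w k y * b k y) x w'" by simp
    also have "\<dots> = (\<Sum>k\<in>UNIV. chart_deriv X c (\<lambda>y. t w k y * b k y) x w')"
      by (rule chart_deriv_sum[OF chart_holomorphic_mult[OF ht hbc] xW])
    also have "\<dots> = (\<Sum>k\<in>UNIV. t w k x * chart_deriv X c (b k) x w' + chart_deriv X c (t w k) x w' * b k x)"
      by (rule sum.cong[OF refl], rule chart_deriv_mult[OF ht hbc xW])
    finally show ?thesis unfolding chart_deriv_chain[OF hb V x] .
  qed
  have c2: "chart_deriv X d (\<lambda>y. \<alpha> d y [w]) x w' = (\<Sum>k\<in>UNIV. w $ k * chart_deriv X d (b k) x w')" for w w'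
  proof -
    have "chart_deriv X d (\<lambda>y. \<alpha> d y [w]) x w' = chart_deriv X d (\<lambda>y. \<Sum>k\<in>UNIV. w $ k * b k y) x w'"
      unfolding b_def by (rule fun_cong[OF chart_deriv_cong[OF V xd]]) (rule hol_form1_expand[OF \<alpha>])
    also have "\<dots> = (\<Sum>k\<in>UNIV. chart_deriv X d (\<lambda>y. w $ k * b k y) x w')"
      by (rule chart_deriv_sum[OF chart_holomorphic_mult[OF chart_holomorphic_const hb] xd])
    finally show ?thesis by (simp only: chart_deriv_scale[OF hb xd])
  qed
  have s: "chart_deriv X c (t u k) x v = chart_deriv X c (t v k) x u" for k
    unfolding t_def by (rule chart_deriv_symmetric[OF chart_holomorphic_transition open_chart_dom xcd])
  show ?thesis
    unfolding ext_deriv_pair[OF xc] ext_deriv_pair[OF xd] c1 c2 t s sum.distrib by simp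
qed

lemma ext_deriv_hol_form:
  assumes \<alpha>: "\<alpha> \<in> hol_form X 1 V" and V: "open V"
  shows "ext_deriv X V \<alpha> \<in> hol_form X 2 V"
proof (rule hol_formI)
  fix c x and vs :: "(complex^'n) list" assume "x \<notin> chart_dom X c \<inter> V \<or> length vs \<noteq> 2"
  then show "ext_deriv X V \<alpha> c x vs = 0"
    by (rule ext_deriv_zero[rotated]) (simp add: hol_form_zero[OF \<alpha>])
next
  fix c x i u w a b and vs :: "(complex^'n) list"
  assume x: "x \<in> chart_dom X c \<inter> V" and "length vs = 2" and i: "i < (2::nat)"
  then obtain p q where vs: "vs = [p, q]" using length_2_cases by metis
  note h = hol_form_holomorphic[OF \<alpha>, of c]
  have l: "chart_deriv X c (\<lambda>y. \<alpha> c y [a *s u + b *s w]) x v =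
     a * chart_deriv X c (\<lambda>y. \<alpha> c y [u]) x v + b * chart_deriv X c (\<lambda>y. \<alpha> c y [w]) x v" for v
  proof -
    have "chart_deriv X c (\<lambda>y. \<alpha> c y [a *s u + b *s w]) x v =
      chart_deriv X c (\<lambda>y. a * \<alpha> c y [u] + b * \<alpha> c y [w]) x v"
      by (rule fun_cong[OF chart_deriv_cong[OF V x]]) (rule hol_form1_linear[OF \<alpha>])
    also have "\<dots> = chart_deriv X c (\<lambda>y. a * \<alpha> c y [u]) x v + chart_deriv X c (\<lambda>y. b * \<alpha> c y [w]) x v"
      by (rule chart_deriv_add[OF _ _ x]) (rule chart_holomorphic_mult[OF chart_holomorphic_const h])+
    finally show ?thesis by (simp only: chart_deriv_scale[OF h x])
  qed
  have "i = 0 \<or> i = 1" using i by auto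
  then show "ext_deriv X V \<alpha> c x (vs[i := a *s u + b *s w]) =
      a * ext_deriv X V \<alpha> c x (vs[i := u]) + b * ext_deriv X V \<alpha> c x (vs[i := w])"
    by (elim disjE)
      (simp_all add: vs ext_deriv_pair[OF x] l chart_deriv_linear[OF h x] right_diff_distrib)
next
  fix c x and i j :: nat and vs :: "(complex^'n) list"
  assume x: "x \<in> chart_dom X c \<inter> V" and "length vs = 2" and ij: "i < j" "j < 2" "vs ! i = vs ! j"
  then obtain p q where vs: "vs = [p, q]" using length_2_cases by metis
  have "i = 0" "j = 1" using ij by auto
  then have "p = q" using ij(3) vs by simp
  then show "ext_deriv X V \<alpha> c x vs = 0" by (simp add: vs ext_deriv_pair[OF x])
next
  fix c d x and vs :: "(complex^'n) list"
  assume x: "x \<in> chart_dom X c \<inter> chart_dom X d \<inter> V" and "length vs = 2"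
  then obtain p q where vs: "vs = [p, q]" using length_2_cases by metis
  show "ext_deriv X V \<alpha> c x vs = ext_deriv X V \<alpha> d x (map (chart_jac X c d x) vs)"
    unfolding vs using ext_deriv_transform[OF \<alpha> V x, of p q] by simp
next
  fix c and vs :: "(complex^'n) list" assume "length vs = 2"
  then obtain p q where vs: "vs = [p, q]" using length_2_cases by metis
  note h = hol_form_holomorphic[OF \<alpha>, of c]
  have "chart_holomorphic X c V (\<lambda>x. chart_deriv X c (\<lambda>y. \<alpha> c y [q]) x p + (-1) * chart_deriv X c (\<lambda>y. \<alpha> c y [p]) x q)"
    by (intro chart_holomorphic_add chart_holomorphic_mult chart_holomorphic_const chart_holomorphic_deriv h V)
  then show "chart_holomorphic X c V (\<lambda>x. ext_deriv X V \<alpha> c x vs)"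
    by (rule chart_holomorphic_cong[OF V, rotated]) (simp add: vs ext_deriv_pair)
qed

end

section \<open>Connections on line bundles\<close>

lemma hol_fun_zero: "f \<in> hol_fun X V \<Longrightarrow> x \<notin> V \<Longrightarrow> f x = 0"
  and hol_fun_holomorphic: "f \<in> hol_fun X V \<Longrightarrow> chart_holomorphic X c V f"
  unfolding hol_fun_def chart_holomorphic_def by simp_all

lemma hol_sect_fun: "s \<in> hol_sect X F V \<Longrightarrow> s i \<in> hol_fun X (V \<inter> triv_dom F i)"
  and hol_sect_trans: "s \<in> hol_sect X F V \<Longrightarrow> x \<in> V \<inter> triv_dom F i \<inter> triv_dom F j \<Longrightarrow>
    s i x = trans_fun F i j x * s j x"
  unfolding hol_sect_def by blast+

lemma hol_fform_form: "\<tau> \<in> hol_fform X F k V \<Longrightarrow> \<tau> i \<in> hol_form X k (V \<inter> triv_dom F i)"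
  and hol_fform_trans: "\<tau> \<in> hol_fform X F k V \<Longrightarrow> x \<in> V \<inter> triv_dom F i \<inter> triv_dom F j \<Longrightarrow>
    \<tau> i c x vs = trans_fun F i j x * \<tau> j c x vs"
  unfolding hol_fform_def by blast+

locale line_bundle_connection = complex_mfd X
  for X :: "('x::t2_space, 'c, 'n::finite) atlas" +
  fixes F :: "('x, 'i) line_bundle" and D :: "('x, 'i, 'c, 'n) conn"
  assumes line_bundle: "hol_line_bundle X F"
    and connection: "hol_connection X F D"
begin

abbreviation A where "A \<equiv> connection_form F D"

lemma open_triv_dom: "open (triv_dom F i)"
  using line_bundle unfolding hol_line_bundle_def by blast

lemma triv_covers: "\<exists>i. x \<in> triv_dom F i"
  using line_bundle unfolding hol_line_bundle_def by blast

lemma trans_self: "x \<in> triv_dom F i \<Longrightarrow> trans_fun F i i x = 1"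
  using line_bundle unfolding hol_line_bundle_def by blast

lemma trans_cocycle: "x \<in> triv_dom F i \<inter> triv_dom F j \<inter> triv_dom F k \<Longrightarrow>
    trans_fun F i j x * trans_fun F j k x = trans_fun F i k x"
  using line_bundle unfolding hol_line_bundle_def by blast

lemma local_frame_hol_sect: "local_frame F i \<in> hol_sect X F (triv_dom F i)"
proof -
  have "local_frame F i j \<in> hol_fun X (triv_dom F i \<inter> triv_dom F j)" for j
  proof -
    have "local_frame F i j = restrict_to (triv_dom F j \<inter> triv_dom F i) (trans_fun F j i)"
      by (auto simp: local_frame_def restrict_to_def)
    moreover have "restrict_to (triv_dom F j \<inter> triv_dom F i) (trans_fun F j i)
        \<in> hol_fun X (triv_dom F j \<inter> triv_dom F i)"
      using line_bundle unfolding hol_line_bundle_def by blast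
    ultimately show ?thesis by (simp add: Int_commute)
  qed
  moreover have "local_frame F i j x = trans_fun F j k x * local_frame F i k x"
    if "x \<in> triv_dom F i \<inter> triv_dom F j \<inter> triv_dom F k" for j k x
    using that trans_cocycle[of x j k i] by (simp add: local_frame_def Int_ac)
  ultimately show ?thesis unfolding hol_sect_def by blast
qed

lemma local_frame_self: "x \<in> triv_dom F i \<Longrightarrow> local_frame F i i x = 1"
  by (simp add: local_frame_def trans_self)

lemma hol_sect_restrict:
  assumes s: "s \<in> hol_sect X F V" and W: "open W" "W \<subseteq> V"
  shows "(\<lambda>i. restrict_to W (s i)) \<in> hol_sect X F W"
proof -
  have "restrict_to W (s i) \<in> hol_fun X (W \<inter> triv_dom F i)" for i
  proof -
    have "chart_holomorphic X c (W \<inter> triv_dom F i) (s i)" for c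
      by (rule chart_holomorphic_subset[OF hol_fun_holomorphic[OF hol_sect_fun[OF s]]]) (use W in blast)
    then have "chart_holomorphic X c (W \<inter> triv_dom F i) (restrict_to W (s i))" for c
      by (rule chart_holomorphic_cong[rotated 2])
        (simp_all add: restrict_to_def W open_triv_dom open_Int)
    moreover have "restrict_to W (s i) x = 0" if "x \<notin> W \<inter> triv_dom F i" for x
      using that hol_fun_zero[OF hol_sect_fun[OF s], of x i] by (auto simp: restrict_to_def)
    ultimately show ?thesis unfolding hol_fun_def chart_holomorphic_def by blast
  qed
  moreover have "restrict_to W (s i) x = trans_fun F i j x * restrict_to W (s j) x"
    if "x \<in> W \<inter> triv_dom F i \<inter> triv_dom F j" for i j x
    using that W hol_sect_trans[OF s, of x i j] by (auto simp: restrict_to_def)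
  ultimately show ?thesis unfolding hol_sect_def by blast
qed

lemma
  assumes V: "open V" and s: "s \<in> hol_sect X F V"
  shows conn_hol_fform: "D V s \<in> hol_fform X F 1 V"
    and conn_restrict: "open W \<Longrightarrow> W \<subseteq> V \<Longrightarrow>
      D W (\<lambda>i. restrict_to W (s i)) = (\<lambda>i c. restrict_to W (D V s i c))"
    and conn_leibniz: "f \<in> hol_fun X V \<Longrightarrow>
      D V (\<lambda>i x. f x * s i x) =
        tensor_sect (ext_deriv X V (form_of_fun X f)) s + (\<lambda>i c x vs. f x * D V s i c x vs)"
proof -
  note * = mp[OF spec[OF connection[unfolded hol_connection_def], of V] V]
  show "D V s \<in> hol_fform X F 1 V" by (rule bspec[OF conjunct1[OF *] s])
  show "D W (\<lambda>i. restrict_to W (s i)) = (\<lambda>i c. restrict_to W (D V s i c))"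
    if "open W" "W \<subseteq> V"
    by (rule mp[OF spec[OF bspec[OF conjunct1[OF conjunct2[OF conjunct2[OF *]]] s]] conjI[OF that]])
  show "D V (\<lambda>i x. f x * s i x) =
      tensor_sect (ext_deriv X V (form_of_fun X f)) s + (\<lambda>i c x vs. f x * D V s i c x vs)"
    if "f \<in> hol_fun X V"
    by (rule bspec[OF bspec[OF conjunct2[OF conjunct2[OF conjunct2[OF *]]] that] s])
qed

lemma connection_form_hol: "A i \<in> hol_form X 1 (triv_dom F i)"
  unfolding connection_form_def
  using hol_fform_form[OF conn_hol_fform[OF open_triv_dom local_frame_hol_sect], of i i] by simp

text \<open>In a trivialisation the connection is d + A: over \<open>V \<inter> triv_dom F i\<close>
  the section is its \<open>i\<close>-th component times the frame, and the Leibniz rule applies to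
  this product after restriction.\<close>

lemma conn_local:
  assumes V: "open V" and s: "s \<in> hol_sect X F V" and x: "x \<in> chart_dom X c \<inter> (V \<inter> triv_dom F i)"
  shows "D V s i c x [v] = chart_deriv X c (s i) x v + s i x * A i c x [v]"
proof -
  define W where "W = V \<inter> triv_dom F i"
  define t where "t = (\<lambda>j. restrict_to W (local_frame F i j))"
  have W: "open W" "W \<subseteq> V" "W \<subseteq> triv_dom F i" unfolding W_def using V open_triv_dom by auto
  have xW: "x \<in> W" "x \<in> chart_dom X c \<inter> W" using x by (auto simp: W_def)
  have t: "t \<in> hol_sect X F W"
    unfolding t_def by (rule hol_sect_restrict[OF local_frame_hol_sect W(1,3)])
  \<comment> \<open>Sections are total functions, so the identity must also be checked off
    \<open>W\<close> and off \<open>triv_dom F j\<close>, where both sides are 0.\<close>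
  have "restrict_to W (s j) y = s i y * t j y" for j y
  proof (cases "y \<in> W")
    case True
    show ?thesis
    proof (cases "y \<in> triv_dom F j")
      case j: True
      then have "s j y = trans_fun F j i y * s i y"
        using True by (intro hol_sect_trans[OF s]) (simp add: W_def)
      then show ?thesis using True j by (simp add: restrict_to_def t_def local_frame_def W_def)
    next
      case False
      then have "s j y = 0" by (intro hol_fun_zero[OF hol_sect_fun[OF s]]) simp
      then show ?thesis using False by (simp add: restrict_to_def t_def local_frame_def)
    qed
  qed (simp add: restrict_to_def t_def)
  then have eq: "(\<lambda>j. restrict_to W (s j)) = (\<lambda>j y. s i y * t j y)" by (intro ext)
  have si: "s i \<in> hol_fun X W" unfolding W_def by (rule hol_sect_fun[OF s])
  have "D V s i c x [v] = D W (\<lambda>j. restrict_to W (s j)) i c x [v]"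
    using xW by (simp add: conn_restrict[OF V s W(1,2)] restrict_to_def)
  also have "\<dots> = (tensor_sect (ext_deriv X W (form_of_fun X (s i))) t + (\<lambda>j c x vs. s i x * D W t j c x vs)) i c x [v]"
    unfolding eq conn_leibniz[OF W(1) t si] ..
  also have "\<dots> = chart_deriv X c (s i) x v * t i x + s i x * D W t i c x [v]"
    using xW by (simp add: tensor_sect_def ext_deriv_fun)
  also have "t i x = 1" using x xW by (simp add: t_def restrict_to_def local_frame_self)
  also have "D W t i c x [v] = A i c x [v]"
    using xW unfolding t_def conn_restrict[OF open_triv_dom local_frame_hol_sect W(1,3)] connection_form_def
    by (simp add: restrict_to_def)
  finally show ?thesis by simp
qed

lemma trans_fun_nonzero:
  assumes "x \<in> triv_dom F i \<inter> triv_dom F j"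
  shows "trans_fun F i j x \<noteq> 0"
  using trans_cocycle[of x i j i] trans_self[of x i] assms by auto

text \<open>The gauge rule A_j = A_i + df / f with denominators cleared, where f is the transition
  function. The \<open>i\<close>-th component of D applied to the \<open>j\<close>-th frame is
  computed twice: by the transition rule for F-valued forms and by
  \<open>conn_local\<close>.\<close>

lemma connection_form_change:
  assumes "x \<in> chart_dom X c \<inter> (triv_dom F i \<inter> triv_dom F j)"
  shows "local_frame F j i x * A j c x [v] =
     chart_deriv X c (local_frame F j i) x v + local_frame F j i x * A i c x [v]"
proof -
  have "D (triv_dom F j) (local_frame F j) i c x [v] = trans_fun F i j x * A j c x [v]"
    unfolding connection_form_def
    by (rule hol_fform_trans[OF conn_hol_fform[OF open_triv_dom local_frame_hol_sect]]) (use assms in blast)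
  moreover have "local_frame F j i x = trans_fun F i j x" using assms by (simp add: local_frame_def)
  moreover have "D (triv_dom F j) (local_frame F j) i c x [v] =
      chart_deriv X c (local_frame F j i) x v + local_frame F j i x * A i c x [v]"
    by (rule conn_local[OF open_triv_dom local_frame_hol_sect]) (use assms in blast)
  ultimately show ?thesis by simp
qed

text \<open>Apply d to the gauge rule f A_j = df + f A_i. Since ddf = 0, the leftover is df wedge
  (A_j - A_i), and the gauge rule solved for df turns it into f (A_j - A_i) wedge (A_j - A_i) = 0;
  then f is divided out.\<close>

lemma curvature_well_defined:
  assumes x: "x \<in> triv_dom F i \<inter> triv_dom F j"
  shows "ext_deriv X (triv_dom F i) (A i) c x vs = ext_deriv X (triv_dom F j) (A j) c x vs"
proof (cases "x \<in> chart_dom X c \<and> length vs = 2")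
  case False
  have "ext_deriv X (triv_dom F k) (A k) c x vs = 0" for k
    by (rule ext_deriv_zero) (use False hol_form_zero[OF connection_form_hol] in auto)
  then show ?thesis by simp
next
  case True
  then obtain u v where vs: "vs = [u, v]" using length_2_cases by blast
  define W where "W = triv_dom F i \<inter> triv_dom F j"
  have W: "open W" and xW: "x \<in> chart_dom X c \<inter> W" and xi: "x \<in> chart_dom X c \<inter> triv_dom F i"
    and xj: "x \<in> chart_dom X c \<inter> triv_dom F j"
    unfolding W_def using open_triv_dom x True by auto
  define f where "f = local_frame F j i"
  have hf: "chart_holomorphic X c W f"
    using hol_fun_holomorphic[OF hol_sect_fun[OF local_frame_hol_sect], of c j i]
    unfolding f_def W_def by (simp add: Int_commute)
  have hi: "chart_holomorphic X c W (\<lambda>y. A i c y [w])" for w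
    by (rule chart_holomorphic_subset[OF hol_form_holomorphic[OF connection_form_hol]]) (simp add: W_def)
  have hj: "chart_holomorphic X c W (\<lambda>y. A j c y [w])" for w
    by (rule chart_holomorphic_subset[OF hol_form_holomorphic[OF connection_form_hol]]) (simp add: W_def)
  have fne: "f x \<noteq> 0" using x trans_fun_nonzero[OF x] by (simp add: f_def local_frame_def)
  have ch: "f y * A j c y [w] = chart_deriv X c f y w + f y * A i c y [w]"
    if "y \<in> chart_dom X c \<inter> W" for y w
    using connection_form_change[of y c i j w] that unfolding f_def W_def by blast
  define P where "P w w' = chart_deriv X c (\<lambda>y. A i c y [w]) x w'" for w w'
  define Q where "Q w w' = chart_deriv X c (\<lambda>y. A j c y [w]) x w'" for w w'
  define H where "H w w' = chart_deriv X c (\<lambda>y. chart_deriv X c f y w) x w'" for w w'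
  define G where "G w = chart_deriv X c f x w" for w
  have d: "f x * Q w w' + G w' * A j c x [w] = H w w' + (f x * P w w' + G w' * A i c x [w])" for w w'
  proof -
    have "f x * Q w w' + G w' * A j c x [w] = chart_deriv X c (\<lambda>y. f y * A j c y [w]) x w'"
      unfolding Q_def G_def by (rule chart_deriv_mult[OF hf hj xW, symmetric])
    also have "\<dots> = chart_deriv X c (\<lambda>y. chart_deriv X c f y w + f y * A i c y [w]) x w'"
      by (rule fun_cong[OF chart_deriv_cong[OF W xW ch]])
    also have "\<dots> = H w w' + chart_deriv X c (\<lambda>y. f y * A i c y [w]) x w'"
      unfolding H_def
      by (rule chart_deriv_add[OF chart_holomorphic_deriv[OF hf W] chart_holomorphic_mult[OF hf hi] xW])
    also have "chart_deriv X c (\<lambda>y. f y * A i c y [w]) x w' = f x * P w w' + G w' * A i c x [w]"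
      unfolding P_def G_def by (rule chart_deriv_mult[OF hf hi xW])
    finally show ?thesis .
  qed
  have H: "H u v = H v u" unfolding H_def by (rule chart_deriv_symmetric[OF hf W xW])
  have G: "G w = f x * (A j c x [w] - A i c x [w])" for w
    using ch[OF xW, of w] unfolding G_def by (simp add: algebra_simps)
  have "f x * (Q v u - Q u v) = f x * (P v u - P u v)"
    using arg_cong2[of _ _ _ _ minus, OF d[of v u] d[of u v]] H unfolding G by (simp add: algebra_simps)
  then have "P v u - P u v = Q v u - Q u v" using fne by simp
  then show ?thesis unfolding vs ext_deriv_pair[OF xi] ext_deriv_pair[OF xj] P_def Q_def .
qed

text \<open>A concrete candidate for the form that \<open>curvature_form\<close> describes. Choosing
  a trivialisation separately at each point is harmless by
  \<open>curvature_well_defined\<close>.\<close>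

definition curv :: "('x,'c,'n) form" where
  "curv c x vs = (let i = SOME i. x \<in> triv_dom F i in ext_deriv X (triv_dom F i) (A i) c x vs)"

lemma curv_eq:
  assumes "x \<in> triv_dom F i"
  shows "curv c x vs = ext_deriv X (triv_dom F i) (A i) c x vs"
proof -
  have "x \<in> triv_dom F (SOME i. x \<in> triv_dom F i)" using assms by (rule someI)
  then show ?thesis unfolding curv_def Let_def using assms by (intro curvature_well_defined) blast
qed

lemma curv_hol_form: "curv \<in> hol_form X 2 UNIV"
proof (rule hol_form_local)
  fix x
  obtain i where "x \<in> triv_dom F i" using triv_covers by blast
  then show "\<exists>W \<beta>. open W \<and> x \<in> W \<and> \<beta> \<in> hol_form X 2 W \<and> (\<forall>y\<in>W. \<forall>c vs. curv c y vs = \<beta> c y vs)"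
    by (intro exI[of _ "triv_dom F i"] exI[of _ "ext_deriv X (triv_dom F i) (A i)"] conjI ballI allI
        open_triv_dom ext_deriv_hol_form[OF connection_form_hol open_triv_dom]) (simp_all add: curv_eq)
qed

section \<open>Curvature and induced connection as scalar 2-forms\<close>

lemma form2_eqI:
  assumes "\<And>c x vs. x \<notin> chart_dom X c \<inter> V \<or> length vs \<noteq> 2 \<Longrightarrow> \<alpha> c x vs = \<beta> c x vs"
    and "\<And>c x u v. x \<in> chart_dom X c \<inter> V \<Longrightarrow> \<alpha> c x [u, v] = \<beta> c x [u, v]"
  shows "\<alpha> = \<beta>"
proof (intro ext)
  fix c x vs
  show "\<alpha> c x vs = \<beta> c x vs"
  proof (cases "x \<in> chart_dom X c \<inter> V \<and> length vs = 2")
    case True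
    then obtain u v where "vs = [u, v]" using length_2_cases by blast
    then show ?thesis using True assms(2) by blast
  next
    case False
    then show ?thesis by (intro assms(1)) blast
  qed
qed

text \<open>Uniqueness in the definite description comes from testing on local frames: the
  \<open>i\<close>-th component of the \<open>i\<close>-th frame is 1, so the tensor product returns
  the form itself.\<close>

lemma end_form_eq:
  assumes \<kappa>: "\<kappa> \<in> hol_form X 2 UNIV"
    and T: "\<And>V s. open V \<Longrightarrow> s \<in> hol_sect X F V \<Longrightarrow> T V s = tensor_sect \<kappa> s"
  shows "end_form X F T = \<kappa>"
  unfolding end_form_def
proof (rule the_equality)
  show "\<kappa> \<in> hol_form X 2 UNIV \<and> (\<forall>V. open V \<longrightarrow> (\<forall>s \<in> hol_sect X F V. T V s = tensor_sect \<kappa> s))"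
    using assms by blast
next
  fix \<kappa>' assume *: "\<kappa>' \<in> hol_form X 2 UNIV \<and> (\<forall>V. open V \<longrightarrow> (\<forall>s \<in> hol_sect X F V. T V s = tensor_sect \<kappa>' s))"
  show "\<kappa>' = \<kappa>"
  proof (intro ext)
    fix c x vs
    obtain i where i: "x \<in> triv_dom F i" using triv_covers by blast
    have "tensor_sect \<kappa>' (local_frame F i) = tensor_sect \<kappa> (local_frame F i)"
      using * T open_triv_dom local_frame_hol_sect by metis
    from fun_cong[OF fun_cong[OF fun_cong[OF fun_cong[OF this, of i], of c], of x], of vs]
    show "\<kappa>' c x vs = \<kappa> c x vs" by (simp add: tensor_sect_def local_frame_self[OF i])
  qed
qed

lemma tensor_sect_zero:
  assumes "\<alpha> \<in> hol_form X k UNIV" "s \<in> hol_sect X F V"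
    and "x \<notin> chart_dom X c \<inter> (V \<inter> triv_dom F i) \<or> length vs \<noteq> k"
  shows "tensor_sect \<alpha> s i c x vs = 0"
  using assms(3) hol_form_zero[OF assms(1), of x c vs] hol_fun_zero[OF hol_sect_fun[OF assms(2)], of x i]
  unfolding tensor_sect_def by auto

lemma conn_zero:
  assumes "open V" "s \<in> hol_sect X F V" "x \<notin> chart_dom X c \<inter> (V \<inter> triv_dom F i) \<or> length vs \<noteq> 1"
  shows "D V s i c x vs = 0"
  using hol_form_zero[OF hol_fform_form[OF conn_hol_fform[OF assms(1,2)]] assms(3)] .

text \<open>Equality of operators is equality of total functions; this settles the points outside
  the domain and the lists of wrong length. \<open>D'\<close> is arbitrary so that both the given
  and the shifted connection are covered.\<close>

lemma conn_ext_zero: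
  assumes \<tau>: "\<And>y vs. y \<notin> chart_dom X c \<inter> (V \<inter> triv_dom F i) \<or> length vs \<noteq> 1 \<Longrightarrow> \<tau> i c y vs = 0"
    and x: "x \<notin> chart_dom X c \<inter> (V \<inter> triv_dom F i) \<or> length vs \<noteq> 2"
  shows "conn_ext X F D' V \<tau> i c x vs = 0"
proof -
  have "ext_deriv X (V \<inter> triv_dom F i) (\<tau> i) c x vs = 0"
    using x by (intro ext_deriv_zero \<tau>) auto
  moreover have "wedge1 \<alpha> (\<tau> i) c x vs = 0" for \<alpha>
  proof (cases "length vs = 2")
    case True
    then show ?thesis using x unfolding wedge1_def by (intro sum.neutral ballI) (simp add: \<tau>)
  qed (intro wedge1_zero \<tau>, auto)
  ultimately show ?thesis by (simp add: conn_ext_def)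
qed

text \<open>With B = A_i + E the curvature of a section is d(ds_i + s_i B) + B wedge (ds_i + s_i B).
  Here dds_i and B wedge B vanish and ds_i wedge B cancels B wedge ds_i, which leaves s_i (dA_i +
  dE), with no term quadratic in E.\<close>

lemma curvature_conn_add:
  assumes E: "E \<in> hol_form X 1 UNIV" and V: "open V" and s: "s \<in> hol_sect X F V"
  shows "curvature X F (conn_add D E) V s = tensor_sect (\<lambda>c x vs. curv c x vs + ext_deriv X UNIV E c x vs) s"
proof (rule ext)
  fix i
  define W where "W = V \<inter> triv_dom F i"
  define \<tau> where "\<tau> = conn_add D E V s"
  have \<tau>i: "\<tau> i c x vs = D V s i c x vs + E c x vs * s i x" for c x vs
    unfolding \<tau>_def conn_add_def by (simp add: tensor_sect_def)
  have W: "open W" unfolding W_def using V open_triv_dom by blast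
  have dE: "ext_deriv X UNIV E \<in> hol_form X 2 UNIV" by (rule ext_deriv_hol_form[OF E open_UNIV])
  show "curvature X F (conn_add D E) V s i = tensor_sect (\<lambda>c x vs. curv c x vs + ext_deriv X UNIV E c x vs) s i"
  proof (rule form2_eqI[where V=W])
    fix c x and vs :: "(complex^'n) list" assume x: "x \<notin> chart_dom X c \<inter> W \<or> length vs \<noteq> 2"
    have "curvature X F (conn_add D E) V s i c x vs = 0"
      unfolding curvature_def
    proof (rule conn_ext_zero)
      show "conn_add D E V s i c y vs = 0" if "y \<notin> chart_dom X c \<inter> (V \<inter> triv_dom F i) \<or> length vs \<noteq> 1" for y vs
        using conn_zero[OF V s that] tensor_sect_zero[OF E s that] by (simp add: conn_add_def)
    qed (rule x[unfolded W_def])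
    moreover have "tensor_sect (\<lambda>c x vs. curv c x vs + ext_deriv X UNIV E c x vs) s i c x vs = 0"
      using tensor_sect_zero[OF curv_hol_form s x[unfolded W_def]] tensor_sect_zero[OF dE s x[unfolded W_def]]
      unfolding tensor_sect_def distrib_right by (simp only: add_0)
    ultimately show "curvature X F (conn_add D E) V s i c x vs =
      tensor_sect (\<lambda>c x vs. curv c x vs + ext_deriv X UNIV E c x vs) s i c x vs" by simp
  next
    fix c x and u v :: "complex^'n" assume xW: "x \<in> chart_dom X c \<inter> W"
    have xi: "x \<in> chart_dom X c \<inter> triv_dom F i" and xU: "x \<in> chart_dom X c \<inter> UNIV"
      and xi': "x \<in> triv_dom F i" using xW W_def by auto
    have hf: "chart_holomorphic X c W (s i)" unfolding W_def by (rule hol_fun_holomorphic[OF hol_sect_fun[OF s]])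
    have hE: "chart_holomorphic X c W (\<lambda>y. E c y [w])" for w
      by (rule chart_holomorphic_subset[OF hol_form_holomorphic[OF E]]) simp
    have hA: "chart_holomorphic X c W (\<lambda>y. A i c y [w])" for w
      by (rule chart_holomorphic_subset[OF hol_form_holomorphic[OF connection_form_hol]]) (simp add: W_def)
    note hB = chart_holomorphic_add[OF hA hE]
    have \<tau>1: "\<tau> i c y [w] = chart_deriv X c (s i) y w + s i y * (A i c y [w] + E c y [w])"
      if "y \<in> chart_dom X c \<inter> W" for y w
      using conn_local[OF V s that[unfolded W_def], of w] by (simp add: \<tau>i algebra_simps)
    \<comment> \<open>\<open>conn_ext\<close> takes its connection form from the shifted connection,
      so E enters here as well as through \<open>\<tau>\<close>.\<close>
    have cf: "connection_form F (conn_add D E) i c x [w] = A i c x [w] + E c x [w]" for w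
      using local_frame_self[OF xi'] by (simp add: connection_form_def conn_add_def tensor_sect_def)
    have d\<tau>: "chart_deriv X c (\<lambda>y. \<tau> i c y [w]) x w' =
       chart_deriv X c (\<lambda>y. chart_deriv X c (s i) y w) x w' +
       (s i x * (chart_deriv X c (\<lambda>y. A i c y [w]) x w' + chart_deriv X c (\<lambda>y. E c y [w]) x w') +
       chart_deriv X c (s i) x w' * (A i c x [w] + E c x [w]))" for w w'
    proof -
      have "chart_deriv X c (\<lambda>y. \<tau> i c y [w]) x w' =
         chart_deriv X c (\<lambda>y. chart_deriv X c (s i) y w + s i y * (A i c y [w] + E c y [w])) x w'"
        by (rule fun_cong[OF chart_deriv_cong[OF W xW \<tau>1]])
      also have "\<dots> = chart_deriv X c (\<lambda>y. chart_deriv X c (s i) y w) x w' +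
          chart_deriv X c (\<lambda>y. s i y * (A i c y [w] + E c y [w])) x w'"
        by (rule chart_deriv_add[OF chart_holomorphic_deriv[OF hf W] chart_holomorphic_mult[OF hf hB] xW])
      also have "chart_deriv X c (\<lambda>y. s i y * (A i c y [w] + E c y [w])) x w' =
          s i x * chart_deriv X c (\<lambda>y. A i c y [w] + E c y [w]) x w' +
          chart_deriv X c (s i) x w' * (A i c x [w] + E c x [w])"
        by (rule chart_deriv_mult[OF hf hB xW])
      also have "chart_deriv X c (\<lambda>y. A i c y [w] + E c y [w]) x w' =
          chart_deriv X c (\<lambda>y. A i c y [w]) x w' + chart_deriv X c (\<lambda>y. E c y [w]) x w'"
        by (rule chart_deriv_add[OF hA hE xW])
      finally show ?thesis .
    qed
    have "curvature X F (conn_add D E) V s i c x [u, v] =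
       ext_deriv X W (\<tau> i) c x [u, v] + wedge1 (connection_form F (conn_add D E) i) (\<tau> i) c x [u, v]"
      by (simp add: curvature_def conn_ext_def \<tau>_def W_def)
    also have "\<dots> = s i x * (chart_deriv X c (\<lambda>y. A i c y [v]) x u - chart_deriv X c (\<lambda>y. A i c y [u]) x v +
        (chart_deriv X c (\<lambda>y. E c y [v]) x u - chart_deriv X c (\<lambda>y. E c y [u]) x v))"
      unfolding ext_deriv_pair[OF xW] wedge1_pair d\<tau> cf \<tau>1[OF xW] chart_deriv_symmetric[OF hf W xW, of v u]
      by (simp add: algebra_simps)
    finally show "curvature X F (conn_add D E) V s i c x [u, v] =
        tensor_sect (\<lambda>c x vs. curv c x vs + ext_deriv X UNIV E c x vs) s i c x [u, v]"
      by (simp add: tensor_sect_def curv_eq[OF xi'] ext_deriv_pair[OF xi] ext_deriv_pair[OF xU] mult.commute)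
  qed
qed

text \<open>The term - E wedge ds_i in d(s_i E) cancels against E wedge D s, and A_i wedge E + E
  wedge A_i = 0 for scalar forms. Thus the connection induced on endomorphisms is d, whatever D
  is.\<close>

lemma conn_end_operator:
  assumes E: "E \<in> hol_form X 1 UNIV" and V: "open V" and s: "s \<in> hol_sect X F V"
  shows "conn_ext X F D V (tensor_sect E s) + (\<lambda>i. wedge1 E (D V s i)) = tensor_sect (ext_deriv X UNIV E) s"
proof (rule ext)
  fix i
  define W where "W = V \<inter> triv_dom F i"
  have W: "open W" unfolding W_def using V open_triv_dom by blast
  have dE: "ext_deriv X UNIV E \<in> hol_form X 2 UNIV" by (rule ext_deriv_hol_form[OF E open_UNIV])
  show "(conn_ext X F D V (tensor_sect E s) + (\<lambda>i. wedge1 E (D V s i))) i = tensor_sect (ext_deriv X UNIV E) s i"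
  proof (rule form2_eqI[where V=W])
    fix c x and vs :: "(complex^'n) list" assume x: "x \<notin> chart_dom X c \<inter> W \<or> length vs \<noteq> 2"
    have "conn_ext X F D V (tensor_sect E s) i c x vs = 0"
      by (rule conn_ext_zero[OF tensor_sect_zero[OF E s] x[unfolded W_def]])
    moreover have "wedge1 E (D V s i) c x vs = 0"
    proof (cases "length vs = 2")
      case True
      then have "x \<notin> chart_dom X c \<inter> (V \<inter> triv_dom F i)" using x by (simp add: W_def)
      then show ?thesis unfolding wedge1_def by (intro sum.neutral ballI) (simp add: conn_zero[OF V s])
    qed (intro wedge1_zero conn_zero[OF V s], auto)
    moreover have "tensor_sect (ext_deriv X UNIV E) s i c x vs = 0"
      by (rule tensor_sect_zero[OF dE s x[unfolded W_def]])
    ultimately show "(conn_ext X F D V (tensor_sect E s) + (\<lambda>i. wedge1 E (D V s i))) i c x vs =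
       tensor_sect (ext_deriv X UNIV E) s i c x vs" by simp
  next
    fix c x and u v :: "complex^'n" assume xW: "x \<in> chart_dom X c \<inter> W"
    have xU: "x \<in> chart_dom X c \<inter> UNIV" using xW by auto
    have hf: "chart_holomorphic X c W (s i)" unfolding W_def by (rule hol_fun_holomorphic[OF hol_sect_fun[OF s]])
    have hE: "chart_holomorphic X c W (\<lambda>y. E c y [w])" for w
      by (rule chart_holomorphic_subset[OF hol_form_holomorphic[OF E]]) simp
    have d: "chart_deriv X c (\<lambda>y. tensor_sect E s i c y [w]) x w' =
       E c x [w] * chart_deriv X c (s i) x w' + chart_deriv X c (\<lambda>y. E c y [w]) x w' * s i x" for w w'
      unfolding tensor_sect_def by (rule chart_deriv_mult[OF hE hf xW])
    have "(conn_ext X F D V (tensor_sect E s) + (\<lambda>i. wedge1 E (D V s i))) i c x [u, v] =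
       ext_deriv X W (tensor_sect E s i) c x [u, v] + wedge1 (A i) (tensor_sect E s i) c x [u, v]
       + wedge1 E (D V s i) c x [u, v]"
      by (simp add: conn_ext_def W_def)
    also have "\<dots> = (chart_deriv X c (\<lambda>y. E c y [v]) x u - chart_deriv X c (\<lambda>y. E c y [u]) x v) * s i x"
      unfolding ext_deriv_pair[OF xW] wedge1_pair d conn_local[OF V s xW[unfolded W_def]]
      by (simp add: tensor_sect_def algebra_simps)
    finally show "(conn_ext X F D V (tensor_sect E s) + (\<lambda>i. wedge1 E (D V s i))) i c x [u, v] =
       tensor_sect (ext_deriv X UNIV E) s i c x [u, v]"
      unfolding tensor_sect_def ext_deriv_pair[OF xU] .
  qed
qed

lemma conn_end_eq: "E \<in> hol_form X 1 UNIV \<Longrightarrow> conn_end X F D E = ext_deriv X UNIV E"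
  unfolding conn_end_def
  by (rule end_form_eq[OF ext_deriv_hol_form[OF _ open_UNIV] conn_end_operator])

text \<open>The single summand \<alpha> = (-i \<alpha>) i suffices: multiplication by the constant i
  is antihermitian for every metric. Hence the test forms in the Yang-Mills condition and in
  genericity are all global holomorphic forms.\<close>

lemma antiherm_form_eq: "antiherm_form X F h k UNIV = hol_form X k UNIV"
proof
  show "hol_form X k UNIV \<subseteq> antiherm_form X F h k UNIV"
  proof
    fix \<alpha> assume \<alpha>: "\<alpha> \<in> hol_form X k UNIV"
    have i: "(\<lambda>x. \<i>) \<in> antiherm_end X F h UNIV"
      unfolding antiherm_end_def hol_fun_def by (auto simp: holomorphic_Cn_const)
    have w: "(\<lambda>c x vs. - \<i> * \<alpha> c x vs) \<in> hol_form X k UNIV" by (rule hol_form_scale[OF \<alpha>])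
    have "\<exists>(m::nat) \<omega> \<phi>. (\<forall>j<m. \<omega> j \<in> hol_form X k UNIV \<and> \<phi> j \<in> antiherm_end X F h UNIV) \<and>
        (\<forall>c vs. \<forall>y\<in>UNIV. \<alpha> c y vs = (\<Sum>j<m. \<omega> j c y vs * \<phi> j y))"
      by (rule exI[of _ 1], rule exI[of _ "\<lambda>_ c x vs. - \<i> * \<alpha> c x vs"], rule exI[of _ "\<lambda>_ _. \<i>"])
        (use i w in \<open>simp add: complex_eq_iff\<close>)
    then show "\<alpha> \<in> antiherm_form X F h k UNIV"
      unfolding antiherm_form_def using \<alpha> open_UNIV by blast
  qed
qed (auto simp: antiherm_form_def)

lemma ext_deriv_scale:
  assumes E: "E \<in> hol_form X 1 UNIV"
  shows "ext_deriv X UNIV (\<lambda>c x vs. a * E c x vs) = (\<lambda>c x vs. a * ext_deriv X UNIV E c x vs)"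
proof (rule form2_eqI[where V=UNIV])
  fix c x and vs :: "(complex^'n) list" assume x: "x \<notin> chart_dom X c \<inter> UNIV \<or> length vs \<noteq> 2"
  show "ext_deriv X UNIV (\<lambda>c x vs. a * E c x vs) c x vs = a * ext_deriv X UNIV E c x vs"
    using hol_form_zero[OF ext_deriv_hol_form[OF E open_UNIV] x]
      hol_form_zero[OF ext_deriv_hol_form[OF hol_form_scale[OF E, of a] open_UNIV] x] by simp
next
  fix c x and u v :: "complex^'n" assume x: "x \<in> chart_dom X c \<inter> UNIV"
  show "ext_deriv X UNIV (\<lambda>c x vs. a * E c x vs) c x [u, v] = a * ext_deriv X UNIV E c x [u, v]"
    unfolding ext_deriv_pair[OF x] chart_deriv_scale[OF hol_form_holomorphic[OF E] x]
    by (simp add: right_diff_distrib)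
qed

text \<open>The curvature operator of \<open>D\<close> itself is read off from
  \<open>curvature_conn_add\<close> with the zero form as \<open>E\<close>.\<close>

lemma flat_if_curv_zero:
  assumes "curv = 0"
  shows "flat_connection X F D"
  unfolding flat_connection_def
proof (intro allI impI ballI)
  fix V s assume V: "open V" and s: "s \<in> hol_sect X F V"
  define Z :: "('x,'c,'n) form" where "Z = (\<lambda>c x vs. 0)"
  have Z: "Z \<in> hol_form X 1 UNIV"
    unfolding Z_def by (rule hol_formI) (simp_all add: chart_holomorphic_const)
  have "conn_add D Z = D"
    by (intro ext) (simp add: conn_add_def tensor_sect_def Z_def)
  then have "curvature X F D V s = tensor_sect (\<lambda>c x vs. curv c x vs + ext_deriv X UNIV Z c x vs) s"
    using curvature_conn_add[OF Z V s] by simp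
  moreover have "ext_deriv X UNIV Z c x vs = 0" for c x vs
    by (simp add: ext_deriv_def Z_def chart_deriv_const)
  moreover have "curv c x vs = 0" for c x vs by (simp add: assms)
  ultimately have "curvature X F D V s = tensor_sect (\<lambda>c x vs. 0) s" by simp
  also have "\<dots> = 0" by (intro ext) (simp add: tensor_sect_def)
  finally show "curvature X F D V s = 0" .
qed

lemma curvature_form_conn_add:
  assumes E: "E \<in> hol_form X 1 UNIV" and dE: "ext_deriv X UNIV E = curv"
  shows "curvature_form X F (conn_add D (\<lambda>c x vs. a * E c x vs)) = (\<lambda>c x vs. (1 + a) * curv c x vs)"
  unfolding curvature_form_def
proof (rule end_form_eq[OF hol_form_scale[OF curv_hol_form]])
  fix V s assume V: "open V" and s: "s \<in> hol_sect X F V"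
  show "curvature X F (conn_add D (\<lambda>c x vs. a * E c x vs)) V s = tensor_sect (\<lambda>c x vs. (1 + a) * curv c x vs) s"
    unfolding curvature_conn_add[OF hol_form_scale[OF E] V s] ext_deriv_scale[OF E] dE
    by (simp add: distrib_right)
qed

end

section \<open>Hermitian linear algebra\<close>

locale hermitian_product =
  fixes G :: "complex^'n::finite \<Rightarrow> complex^'n \<Rightarrow> complex"
  assumes linear: "G (a *s u + b *s v) w = a * G u w + b * G v w"
    and hermitian: "G v u = cnj (G u v)"
    and positive: "u \<noteq> 0 \<Longrightarrow> Re (G u u) > 0"
begin

lemma scale_left: "G (a *s u) w = a * G u w"
  using linear[of a u 0 u w] by simp

lemma scale_right: "G u (a *s w) = cnj a * G u w"
  by (metis complex_cnj_mult hermitian scale_left)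

lemma zero_left: "G 0 w = 0"
  using scale_left[of 0 0 w] by simp

lemma add_left: "G (u + v) w = G u w + G v w"
  using linear[of 1 u 1 v w] by simp

lemma minus_left: "G (u - v) w = G u w - G v w"
  using linear[of 1 u "-1" v w] by simp

lemma sum_left: "G (\<Sum>k\<in>I. v k) w = (\<Sum>k\<in>I. G (v k) w)"
  by (induction I rule: infinite_finite_induct) (simp_all add: zero_left add_left)

lemma sum_right: "G w (\<Sum>k\<in>I. v k) = (\<Sum>k\<in>I. G w (v k))"
  by (subst hermitian, subst sum_left, subst cnj_sum) (simp flip: hermitian)

lemma expand: "G u w = (\<Sum>j\<in>UNIV. \<Sum>k\<in>UNIV. u $ j * cnj (w $ k) * G (axis j 1) (axis k 1))"
proof -
  have w: "G v w = (\<Sum>k\<in>UNIV. cnj (w $ k) * G v (axis k 1))" for v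
    by (subst vec_expansion[of w]) (simp only: sum_right scale_right)
  have "G u w = (\<Sum>j\<in>UNIV. u $ j * G (axis j 1) w)"
    by (subst vec_expansion[of u]) (simp only: sum_left scale_left)
  also have "\<dots> = (\<Sum>j\<in>UNIV. \<Sum>k\<in>UNIV. u $ j * cnj (w $ k) * G (axis j 1) (axis k 1))"
    by (subst w) (simp only: sum_distrib_left mult.assoc)
  finally show ?thesis .
qed

text \<open>Gram-Schmidt as an induction over finite sets of indices: while the index
  \<open>a\<close> is missing, there are fewer than \<open>CARD('n)\<close> vectors, so some
  \<open>u\<close> lies outside their span and its orthogonal remainder is nonzero.\<close>

lemma orthonormal_family:
  fixes S :: "'n set"
  assumes "finite S"
  shows "\<exists>f. \<forall>a\<in>S. \<forall>b\<in>S. G (f a) (f b) = (if a = b then 1 else 0)"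
  using assms
proof (induction S rule: finite_induct)
  case (insert a S)
  then obtain f where f: "\<And>b c. b \<in> S \<Longrightarrow> c \<in> S \<Longrightarrow> G (f b) (f c) = (if b = c then 1 else 0)"
    by blast
  have "card (f ` S) < CARD('n)"
    using card_image_le[OF insert(1), of f] psubset_card_mono[of UNIV S] insert(2) by fastforce
  then have "\<not> UNIV \<subseteq> vec.span (f ` S)"
    using vec.dim_le_card[OF _ finite_imageI[OF insert(1)], of UNIV f]
    unfolding vec_dim_card by linarith
  then obtain u where u: "u \<notin> vec.span (f ` S)" by blast
  define v where "v = u - (\<Sum>b\<in>S. G u (f b) *s f b)"
  have "(\<Sum>b\<in>S. G u (f b) *s f b) \<in> vec.span (f ` S)"
    by (intro vec.span_sum vec.span_scale vec.span_base) blast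
  then have "v \<noteq> 0" using u unfolding v_def by auto
  then have "Re (G v v) > 0" by (rule positive)
  moreover have "Im (G v v) = 0" using hermitian[of v v] by (simp add: complex_eq_iff)
  ultimately obtain N where N: "N > 0" "G v v = complex_of_real N"
    by (metis complex_of_real_def complex_surj)
  define g where "g = f(a := complex_of_real (1 / sqrt N) *s v)"
  have v: "G v (f c) = 0" if "c \<in> S" for c
  proof -
    have "(\<Sum>b\<in>S. G u (f b) * G (f b) (f c)) = (\<Sum>b\<in>S. if b = c then G u (f b) else 0)"
      by (rule sum.cong) (simp_all add: f that)
    also have "\<dots> = G u (f c)" using insert(1) that by simp
    finally show ?thesis by (simp add: v_def minus_left sum_left scale_left)
  qed
  have v': "G (f c) v = 0" if "c \<in> S" for c
    using v[OF that] hermitian[of "f c" v] by simp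
  have "complex_of_real (1 / sqrt N) * (complex_of_real (1 / sqrt N) * complex_of_real N) = 1"
    unfolding of_real_mult[symmetric] using N(1) by (simp add: real_div_sqrt)
  then have "G (g a) (g a) = 1"
    by (simp add: g_def scale_left scale_right N(2))
  moreover have "G (g a) (g c) = 0" "G (g c) (g a) = 0" if "c \<in> S" for c
    using that insert(2) by (auto simp: g_def scale_left scale_right v v')
  moreover have "G (g b) (g c) = (if b = c then 1 else 0)" if "b \<in> S" "c \<in> S" for b c
    using that insert(2) f by (auto simp: g_def)
  ultimately show ?case using insert(2) by (intro exI[of _ g]) auto
qed simp

definition gram_matrix :: "complex^'n^'n" where
  "gram_matrix = (\<chi> j k. G (axis j 1) (axis k 1))"

text \<open>The columns of P form a G-orthonormal basis.\<close>

lemma gram_factorization: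
  "\<exists>P :: complex^'n^'n. transpose P ** (gram_matrix ** (\<chi> i j. cnj (P $ i $ j))) = mat 1"
proof -
  obtain f :: "'n \<Rightarrow> complex^'n" where f: "\<And>a b. G (f a) (f b) = (if a = b then 1 else 0)"
    using orthonormal_family[OF finite, of UNIV] by auto
  define P :: "complex^'n^'n" where "P = (\<chi> j a. f a $ j)"
  have "(transpose P ** (gram_matrix ** (\<chi> i j. cnj (P $ i $ j)))) $ a $ b = mat 1 $ a $ b" for a b
  proof -
    have "(transpose P ** (gram_matrix ** (\<chi> i j. cnj (P $ i $ j)))) $ a $ b
      = (\<Sum>j\<in>UNIV. \<Sum>k\<in>UNIV. f a $ j * cnj (f b $ k) * G (axis j 1) (axis k 1))"
      by (simp add: matrix_matrix_mult_def transpose_def P_def gram_matrix_def sum_distrib_left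
          mult.assoc mult.commute[of "G _ _"])
    also have "\<dots> = mat 1 $ a $ b" unfolding expand[symmetric] f by (simp add: mat_def)
    finally show ?thesis .
  qed
  then have "transpose P ** (gram_matrix ** (\<chi> i j. cnj (P $ i $ j))) = mat 1"
    by (simp add: vec_eq_iff)
  then show ?thesis by blast
qed

end

section \<open>Inverse matrices and positivity of the induced product on 2-forms\<close>

lemma det_cnj: "det (\<chi> i j. cnj (P $ i $ j)) = cnj (det (P::complex^'n^'n))"
  by (simp add: det_def)

lemma matrix_inv_eqI:
  fixes A B :: "'a::field^'n^'n"
  assumes "A ** B = mat 1"
  shows "matrix_inv A = B"
proof -
  have BA: "B ** A = mat 1" using assms matrix_left_right_inverse by blast
  have "\<exists>C. A ** C = mat 1 \<and> C ** A = mat 1" using assms BA by blast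
  then have "A ** matrix_inv A = mat 1" unfolding matrix_inv_def by (rule someI2_ex) blast
  then have "B ** (A ** matrix_inv A) = B" by simp
  then show ?thesis by (simp add: matrix_mul_assoc BA)
qed

text \<open>Cramer's rule for the system with right-hand side \<open>axis j 1\<close>. As quotients
  of determinants, the entries of the inverse depend continuously on the matrix.\<close>

lemma matrix_inv_cramer:
  fixes A :: "'a::field^'n^'n"
  assumes "det A \<noteq> 0"
  shows "matrix_inv A $ k $ j = det (\<chi> i l. if l = k then axis j 1 $ i else A $ i $ l) / det A"
proof -
  obtain B where B: "A ** B = mat 1" using assms unfolding invertible_det_nz[symmetric] invertible_def by blast
  have "A *v (matrix_inv A *v axis j 1) = axis j 1"
    unfolding matrix_inv_eqI[OF B] by (simp add: matrix_vector_mul_assoc B)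
  then have "matrix_inv A *v axis j 1 = (\<chi> k. det (\<chi> i l. if l = k then axis j 1 $ i else A $ i $ l) / det A)"
    unfolding cramer[OF assms] .
  moreover have "(matrix_inv A *v axis j 1) $ k = matrix_inv A $ k $ j"
    by (simp add: matrix_vector_mult_def axis_def if_distrib[of "(*) _"] cong: if_cong)
  ultimately show ?thesis by simp
qed

lemma sum_prod_type: "(\<Sum>j\<in>UNIV. \<Sum>k\<in>UNIV. h (j, k)) = (\<Sum>p\<in>(UNIV::('a::finite \<times> 'b::finite) set). h p)"
  by (simp add: sum.cartesian_product flip: UNIV_Times_UNIV)

text \<open>A kernel of Gram type is positive semidefinite: expand each squared modulus as a double
  sum and interchange the summations.\<close>

lemma gram_quadratic_form:
  "(\<Sum>p\<in>S. \<Sum>r\<in>S. (\<Sum>q\<in>Q. K q p * cnj (K q r)) * M p * cnj (M r)) =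
     complex_of_real (\<Sum>q\<in>Q. (cmod (\<Sum>p\<in>S. K q p * M p))\<^sup>2)"
proof -
  have "complex_of_real (\<Sum>q\<in>Q. (cmod (\<Sum>p\<in>S. K q p * M p))\<^sup>2)
      = (\<Sum>q\<in>Q. \<Sum>p\<in>S. \<Sum>r\<in>S. (K q p * M p) * cnj (K q r * M r))"
    by (simp only: of_real_sum complex_norm_square sum_product cnj_sum)
  also have "\<dots> = (\<Sum>p\<in>S. \<Sum>r\<in>S. \<Sum>q\<in>Q. (K q p * M p) * cnj (K q r * M r))"
    by (subst sum.swap, rule sum.cong[OF refl], rule sum.swap)
  also have "\<dots> = (\<Sum>p\<in>S. \<Sum>r\<in>S. (\<Sum>q\<in>Q. K q p * cnj (K q r)) * M p * cnj (M r))"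
    unfolding sum_distrib_right by (intro sum.cong refl) (simp add: mult_ac)
  finally show ?thesis by simp
qed

text \<open>Determinants in the factorisation by an orthonormal basis give det G times the squared
  modulus of det P equal to 1.\<close>

lemma (in hermitian_product) det_gram_positive: "\<exists>d>0. det gram_matrix = complex_of_real d"
proof -
  obtain P :: "complex^'n^'n" where P: "transpose P ** (gram_matrix ** (\<chi> i j. cnj (P $ i $ j))) = mat 1"
    using gram_factorization by blast
  have "det (transpose P ** (gram_matrix ** (\<chi> i j. cnj (P $ i $ j)))) = 1"
    unfolding P by (rule det_I)
  then have "det P * (det gram_matrix * cnj (det P)) = 1"
    by (simp add: det_mul det_cnj)
  then have *: "det gram_matrix * complex_of_real ((cmod (det P))\<^sup>2) = 1"
    by (simp only: complex_norm_square mult_ac)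
  then have "cmod (det P) \<noteq> 0" by auto
  then have "(cmod (det P))\<^sup>2 > 0" by simp
  moreover from this * have "det gram_matrix = complex_of_real (1 / (cmod (det P))\<^sup>2)"
    by (simp add: field_simps)
  ultimately show ?thesis by (intro exI[of _ "1 / (cmod (det P))\<^sup>2"]) simp
qed

text \<open>The inverse Gram matrix is the conjugate of P times the transpose of P, so the fourfold
  sum is the sum of the squared moduli of M on pairs of vectors of the orthonormal basis formed by
  the columns of P. If it vanishes, then \<open>transpose P ** (MM ** P) = 0\<close>, and P is
  invertible.\<close>

lemma (in hermitian_product) gram_form2_positive:
  fixes M :: "'n \<Rightarrow> 'n \<Rightarrow> complex"
  shows "\<exists>q\<ge>0. (\<Sum>j\<in>UNIV. \<Sum>k\<in>UNIV. \<Sum>l\<in>UNIV. \<Sum>m\<in>UNIV.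
      matrix_inv gram_matrix $ l $ j * matrix_inv gram_matrix $ m $ k * M j k * cnj (M l m)) = complex_of_real q \<and>
      (q = 0 \<longrightarrow> (\<forall>j k. M j k = 0))"
proof -
  obtain P :: "complex^'n^'n" where P: "transpose P ** (gram_matrix ** (\<chi> i j. cnj (P $ i $ j))) = mat 1"
    using gram_factorization by blast
  then have "(gram_matrix ** (\<chi> i j. cnj (P $ i $ j))) ** transpose P = mat 1"
    using matrix_left_right_inverse by blast
  then have "gram_matrix ** ((\<chi> i j. cnj (P $ i $ j)) ** transpose P) = mat 1"
    by (simp only: matrix_mul_assoc)
  then have "matrix_inv gram_matrix = (\<chi> i j. cnj (P $ i $ j)) ** transpose P"
    by (rule matrix_inv_eqI)
  then have inv: "matrix_inv gram_matrix $ l $ j = (\<Sum>a\<in>UNIV. P $ j $ a * cnj (P $ l $ a))" for l j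
    by (simp add: matrix_matrix_mult_def transpose_def mult.commute)
  \<comment> \<open>The tensor square of \<open>P\<close>: with pairs as indices the fourfold sum
    becomes a quadratic form of the kind treated in \<open>gram_quadratic_form\<close>.\<close>
  define K where "K q p = P $ fst p $ fst q * P $ snd p $ snd q" for q p :: "'n \<times> 'n"
  define M' where "M' p = M (fst p) (snd p)" for p
  have KK: "(\<Sum>q\<in>UNIV. K q p * cnj (K q r)) =
      matrix_inv gram_matrix $ fst r $ fst p * matrix_inv gram_matrix $ snd r $ snd p" for p r
  proof -
    have "(\<Sum>q\<in>UNIV. K q p * cnj (K q r)) = (\<Sum>a\<in>UNIV. \<Sum>b\<in>UNIV. K (a, b) p * cnj (K (a, b) r))"
      by (rule sum_prod_type[symmetric])
    also have "\<dots> = (\<Sum>a\<in>UNIV. \<Sum>b\<in>UNIV. P $ fst p $ a * cnj (P $ fst r $ a) * (P $ snd p $ b * cnj (P $ snd r $ b)))"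
      by (intro sum.cong refl) (simp add: K_def)
    finally show ?thesis unfolding inv sum_product .
  qed
  define q where "q = (\<Sum>q\<in>UNIV. (cmod (\<Sum>p\<in>UNIV. K q p * M' p))\<^sup>2)"
  have "complex_of_real q = (\<Sum>p\<in>UNIV. \<Sum>r\<in>UNIV. (\<Sum>q\<in>UNIV. K q p * cnj (K q r)) * M' p * cnj (M' r))"
    unfolding q_def by (rule gram_quadratic_form[symmetric])
  also have "\<dots> = (\<Sum>j\<in>UNIV. \<Sum>k\<in>UNIV. \<Sum>l\<in>UNIV. \<Sum>m\<in>UNIV.
      matrix_inv gram_matrix $ l $ j * matrix_inv gram_matrix $ m $ k * M j k * cnj (M l m))"
    by (subst sum_prod_type[symmetric], subst sum_prod_type[symmetric])
      (simp only: KK M'_def fst_conv snd_conv)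
  finally have eq: "(\<Sum>j\<in>UNIV. \<Sum>k\<in>UNIV. \<Sum>l\<in>UNIV. \<Sum>m\<in>UNIV.
      matrix_inv gram_matrix $ l $ j * matrix_inv gram_matrix $ m $ k * M j k * cnj (M l m)) = complex_of_real q" ..
  have "M j k = 0" if "q = 0" for j k
  proof -
    define MM :: "complex^'n^'n" where "MM = (\<chi> j k. M j k)"
    have "(\<Sum>p\<in>UNIV. K (a, b) p * M' p) = 0" for a b
      using that unfolding q_def by (simp add: sum_nonneg_eq_0_iff)
    then have "(\<Sum>j\<in>UNIV. \<Sum>k\<in>UNIV. P $ j $ a * P $ k $ b * M j k) = 0" for a b
      unfolding sum_prod_type[symmetric] K_def M'_def fst_conv snd_conv .
    then have "(transpose P ** (MM ** P)) $ a $ b = 0" for a b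
      by (simp add: matrix_matrix_mult_def transpose_def MM_def sum_distrib_left mult.assoc mult.commute[of "M _ _"])
    then have N: "transpose P ** (MM ** P) = 0" by (simp add: vec_eq_iff)
    obtain R where R: "R ** transpose P = mat 1"
      using P matrix_left_right_inverse by blast
    then have R': "P ** transpose R = mat 1"
      by (metis matrix_transpose_mul transpose_mat transpose_transpose)
    have "MM = (R ** transpose P) ** (MM ** (P ** transpose R))" by (simp add: R R')
    also have "\<dots> = R ** (transpose P ** (MM ** P)) ** transpose R" by (simp only: matrix_mul_assoc)
    also have "\<dots> = 0" unfolding N by (simp add: matrix_matrix_mult_def vec_eq_iff)
    finally show ?thesis by (simp add: MM_def vec_eq_iff)
  qed
  moreover have "q \<ge> 0" unfolding q_def by (intro sum_nonneg) simp
  ultimately show ?thesis using eq by blast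
qed

section \<open>Definiteness of the energy\<close>

lemma continuous_on_det:
  fixes B :: "'a::topological_space \<Rightarrow> complex^'n^'n"
  assumes "\<And>i j. continuous_on S (\<lambda>x. B x $ i $ j)"
  shows "continuous_on S (\<lambda>x. det (B x))"
  unfolding det_def by (intro continuous_intros assms)

lemma continuous_on_matrix_inv:
  fixes B :: "'a::topological_space \<Rightarrow> complex^'n^'n"
  assumes B: "\<And>i j. continuous_on S (\<lambda>x. B x $ i $ j)" and nz: "\<And>x. x \<in> S \<Longrightarrow> det (B x) \<noteq> 0"
  shows "continuous_on S (\<lambda>x. matrix_inv (B x) $ k $ j)"
proof -
  have "continuous_on S (\<lambda>x. det (\<chi> i l. if l = k then axis j 1 $ i else B x $ i $ l) / det (B x))"
  proof (intro continuous_on_divide continuous_on_det B ballI nz)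
    fix i l
    show "continuous_on S (\<lambda>x. (\<chi> i l. if l = k then axis j 1 $ i else B x $ i $ l) $ i $ l)"
      using B[of i l] by (cases "l = k") simp_all
  qed
  then show ?thesis by (rule continuous_on_eq) (simp add: matrix_inv_cramer nz)
qed

text \<open>The full Lebesgue integrand of the energy in a chart, volume factor included; this
  product is what is shown to be real, nonnegative and continuous.\<close>

definition energy_density :: "('x,'c,'n::finite) herm_metric \<Rightarrow> ('x,'c,'n) form \<Rightarrow> 'c \<Rightarrow> 'x \<Rightarrow> complex" where
  "energy_density g \<alpha> c x = form2_inner g \<alpha> \<alpha> c x * det (gram g c x)"

locale compact_kaehler = complex_mfd X
  for X :: "('x::t2_space, 'c, 'n::finite) atlas" +
  fixes g :: "('x, 'c, 'n) herm_metric"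
  assumes compact_space: "compact (UNIV :: 'x set)"
    and kaehler: "kaehler_metric X g"
begin

lemma hermitian_product_metric:
  assumes "x \<in> chart_dom X c"
  shows "hermitian_product (g c x)"
proof -
  have *: "(\<forall>a b u v w. g c x (a *s u + b *s v) w = a * g c x u w + b * g c x v w) \<and>
        (\<forall>u v. g c x v u = cnj (g c x u v)) \<and> (\<forall>u. u \<noteq> 0 \<longrightarrow> Re (g c x u u) > 0)"
    by (rule bspec[OF spec[OF conjunct1[OF kaehler[unfolded kaehler_metric_def]]] assms])
  show ?thesis
    by (rule hermitian_product.intro)
      (rule spec[OF spec[OF spec[OF spec[OF spec[OF conjunct1[OF *]]]]]],
       rule spec[OF spec[OF conjunct1[OF conjunct2[OF *]]]],
       erule mp[OF spec[OF conjunct2[OF conjunct2[OF *]]]])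
qed

lemma gram_eq:
  assumes "x \<in> chart_dom X c"
  shows "gram g c x = hermitian_product.gram_matrix (g c x)"
  unfolding hermitian_product.gram_matrix_def[OF hermitian_product_metric[OF assms]] gram_def ..

lemma energy_density_nonneg:
  assumes "x \<in> chart_dom X c"
  shows "\<exists>q\<ge>0. energy_density g \<alpha> c x = complex_of_real q \<and> (q = 0 \<longrightarrow> \<alpha> c x [axis j 1, axis k 1] = 0)"
proof -
  note hp = hermitian_product_metric[OF assms]
  obtain d where d: "d > 0" "det (gram g c x) = complex_of_real d"
    using hermitian_product.det_gram_positive[OF hp] unfolding gram_eq[OF assms] by blast
  obtain q where q: "q \<ge> 0" "(\<Sum>j\<in>UNIV. \<Sum>k\<in>UNIV. \<Sum>l\<in>UNIV. \<Sum>m\<in>UNIV.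
      matrix_inv (gram g c x) $ l $ j * matrix_inv (gram g c x) $ m $ k *
      \<alpha> c x [axis j 1, axis k 1] * cnj (\<alpha> c x [axis l 1, axis m 1])) = complex_of_real q"
    "q = 0 \<longrightarrow> (\<forall>j k. \<alpha> c x [axis j 1, axis k 1] = 0)"
    using hermitian_product.gram_form2_positive[OF hp, of "\<lambda>j k. \<alpha> c x [axis j 1, axis k 1]"]
    unfolding gram_eq[OF assms] by blast
  have "energy_density g \<alpha> c x = complex_of_real (1/2 * q * d)"
    unfolding energy_density_def form2_inner_def Let_def q(2) d(2) by simp
  then show ?thesis
    using q(1,3) d(1) by (intro exI[of _ "1/2 * q * d"]) auto
qed

lemma chart_inv_continuous: "continuous_on (chart_map X c ` chart_dom X c) (chart_inv X c)"
  and chart_map_continuous: "continuous_on (chart_dom X c) (chart_map X c)"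
  using chart_homeomorphism[of c] unfolding homeomorphism_def by auto

lemma gram_continuous:
  "continuous_on (chart_map X c ` chart_dom X c) (\<lambda>z. gram g c (chart_inv X c z) $ i $ j)"
proof -
  have "smooth_on (chart_map X c ` chart_dom X c) (\<lambda>z. g c (chart_inv X c z) u v)" for u v
    using kaehler unfolding kaehler_metric_def by blast
  then have "continuous_on (chart_map X c ` chart_dom X c) (\<lambda>z. g c (chart_inv X c z) u v)" for u v
    unfolding smooth_on_def by (metis Ck_on.simps(1))
  then show ?thesis by (simp add: gram_def)
qed

lemma det_gram_nonzero: "x \<in> chart_dom X c \<Longrightarrow> det (gram g c x) \<noteq> 0"
  using hermitian_product.det_gram_positive[OF hermitian_product_metric[of x c]] gram_eq[of x c] by fastforce

lemma energy_density_continuous: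
  assumes "\<alpha> \<in> hol_form X 2 UNIV"
  shows "continuous_on (chart_map X c ` chart_dom X c) (\<lambda>z. energy_density g \<alpha> c (chart_inv X c z))"
proof -
  have \<alpha>: "continuous_on (chart_map X c ` chart_dom X c) (\<lambda>z. \<alpha> c (chart_inv X c z) vs)" for vs
    by (rule holomorphic_Cn_continuous_on[OF hol_form_holomorphic[OF assms, of c vs,
            unfolded chart_holomorphic_def Int_UNIV_right]])
  have inv: "continuous_on (chart_map X c ` chart_dom X c) (\<lambda>z. matrix_inv (gram g c (chart_inv X c z)) $ i $ j)" for i j
    by (rule continuous_on_matrix_inv[OF gram_continuous]) (auto simp: chart_inv_map det_gram_nonzero)
  show ?thesis
    unfolding energy_density_def form2_inner_def Let_def
    by (intro continuous_intros \<alpha> inv continuous_on_det gram_continuous)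
qed

section \<open>Borel partitions with closures in charts, and integrability\<close>

lemma chart_neighbourhood: "\<exists>c W. open W \<and> x \<in> W \<and> closure W \<subseteq> chart_dom X c"
proof -
  obtain c where x: "x \<in> chart_dom X c" using chart_covers by blast
  have "open (chart_map X c ` chart_dom X c)" using open_chart_image[OF open_UNIV, of c] by simp
  then obtain r where r: "r > 0" "cball (chart_map X c x) r \<subseteq> chart_map X c ` chart_dom X c"
    using x open_contains_cball by (metis imageI)
  define W where "W = chart_dom X c \<inter> chart_map X c -` ball (chart_map X c x) r"
  \<comment> \<open>A compact set, hence closed in the Hausdorff space, so that it contains the
    closure of \<open>W\<close> taken in the whole manifold and not only in the chart
    domain.\<close>
  define K where "K = chart_inv X c ` cball (chart_map X c x) r"
  have "open W" unfolding W_def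
    by (rule continuous_open_preimage[OF chart_map_continuous open_chart_dom open_ball])
  moreover have "x \<in> W" using x r by (simp add: W_def)
  moreover have "closure W \<subseteq> K"
  proof (rule closure_minimal)
    show "W \<subseteq> K"
    proof
      fix y assume "y \<in> W"
      then show "y \<in> K" unfolding W_def K_def by (intro image_eqI[of _ _ "chart_map X c y"]) (auto simp: chart_inv_map)
    qed
    have "compact K" unfolding K_def
      by (intro compact_continuous_image continuous_on_subset[OF chart_inv_continuous r(2)] compact_cball)
    then show "closed K" by (rule compact_imp_closed)
  qed
  moreover have "K \<subseteq> chart_dom X c" unfolding K_def using r(2) by (force simp: chart_inv_map)
  ultimately show ?thesis by blast
qed

text \<open>\<open>volume_integral\<close> takes a partition by \<open>SOME\<close>, which carries
  information only if one exists. A finite subcover is made disjoint in the order of a list.\<close>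

lemma chart_partition_exists: "\<exists>P. chart_partition X P"
proof -
  obtain c W where W: "\<And>x. open (W x)" "\<And>x. x \<in> W x" "\<And>x. closure (W x) \<subseteq> chart_dom X (c x)"
    using chart_neighbourhood by metis
  obtain T where T: "finite T" "UNIV \<subseteq> (\<Union>x\<in>T. W x)"
    by (rule compactE_image[OF compact_space, of UNIV W]) (use W in auto)
  obtain xs where xs: "set xs = T" using T(1) finite_list by blast
  define B where "B i = W (xs ! i) - (\<Union>j<i. W (xs ! j))" for i
  define P where "P = (\<lambda>i. (c (xs ! i), B i)) ` {..<length xs}"
  have disj: "B i \<inter> B j = {}" if "i \<noteq> j" for i j
    using that unfolding B_def by (cases i j rule: linorder_cases) auto
  have "chart_partition X P"
    unfolding chart_partition_def
  proof (intro conjI ballI impI)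
    show "finite P" by (simp add: P_def)
    show "case p of (c, B) \<Rightarrow> B \<in> sets borel \<and> closure B \<subseteq> chart_dom X c" if "p \<in> P" for p
    proof -
      from that obtain i where p: "p = (c (xs ! i), B i)" unfolding P_def by blast
      have "B i \<in> sets borel" unfolding B_def using W(1) by (intro sets.Diff sets.finite_UN) auto
      moreover have "closure (B i) \<subseteq> closure (W (xs ! i))" by (rule closure_mono) (auto simp: B_def)
      ultimately show ?thesis using W(3) p by auto
    qed
    show "snd p \<inter> snd q = {}" if pq: "p \<in> P" "q \<in> P" "p \<noteq> q" for p q
    proof -
      obtain i j where "p = (c (xs ! i), B i)" "q = (c (xs ! j), B j)" using pq(1,2) unfolding P_def by blast
      moreover from this have "i \<noteq> j" using pq(3) by blast
      ultimately show ?thesis using disj by simp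
    qed
    show "(\<Union>p\<in>P. snd p) = UNIV"
    proof -
      have "\<exists>i<length xs. y \<in> B i" for y
      proof -
        have ex: "\<exists>i. i < length xs \<and> y \<in> W (xs ! i)" using T(2) xs by (force simp: in_set_conv_nth)
        define i where "i = (LEAST i. i < length xs \<and> y \<in> W (xs ! i))"
        have i: "i < length xs" "y \<in> W (xs ! i)" using LeastI_ex[OF ex] unfolding i_def by auto
        have "y \<notin> W (xs ! j)" if "j < i" for j
          using not_less_Least[OF that[unfolded i_def]] that i(1) by simp
        then show ?thesis using i unfolding B_def by blast
      qed
      then show ?thesis unfolding P_def by force
    qed
  qed
  then show ?thesis by blast
qed

text \<open>The image is rewritten as a preimage under the continuous inverse chart, since
  measurability passes to preimages.\<close>

lemma chart_image_borel:
  assumes "B \<in> sets borel" "B \<subseteq> chart_dom X c"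
  shows "chart_map X c ` B \<in> sets borel"
proof -
  let ?O = "chart_map X c ` chart_dom X c"
  have O: "?O \<in> sets borel" using open_chart_image[OF open_UNIV, of c] by simp
  have "chart_inv X c -` B \<inter> space (restrict_space borel ?O) \<in> sets (restrict_space borel ?O)"
    by (rule measurable_sets[OF borel_measurable_continuous_on_restrict[OF chart_inv_continuous] assms(1)])
  then have "chart_inv X c -` B \<inter> ?O \<in> sets borel"
    using O by (simp add: sets_restrict_space_iff space_restrict_space)
  moreover have "chart_inv X c -` B \<inter> ?O = chart_map X c ` B"
    using assms(2) by (force simp: chart_inv_map)
  ultimately show ?thesis by simp
qed

text \<open>The density is continuous on the compact image of \<open>closure B\<close>, which is
  where the condition on closures in \<open>chart_partition\<close> enters. A non-integrable density
  would have integral 0 by convention, and zero energy would then say nothing.\<close>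

lemma energy_integrable:
  assumes "\<alpha> \<in> hol_form X 2 UNIV" "B \<in> sets borel" "closure B \<subseteq> chart_dom X c"
  shows "set_integrable lborel (chart_map X c ` B) (\<lambda>z. energy_density g \<alpha> c (chart_inv X c z))"
proof (rule set_integrable_subset)
  have "compact (closure B)" using compact_space by (metis closed_closure compact_Int_closed Int_UNIV_left)
  then have "compact (chart_map X c ` closure B)"
    by (intro compact_continuous_image continuous_on_subset[OF chart_map_continuous assms(3)])
  then show "set_integrable lborel (chart_map X c ` closure B) (\<lambda>z. energy_density g \<alpha> c (chart_inv X c z))"
    unfolding set_integrable_def using assms(3)
    by (intro borel_integrable_compact continuous_on_subset[OF energy_density_continuous[OF assms(1)]] image_mono)
  show "chart_map X c ` B \<in> sets lborel"
    using chart_image_borel[OF assms(2)] assms(3) closure_subset[of B] by auto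
  show "chart_map X c ` B \<subseteq> chart_map X c ` closure B" by (intro image_mono closure_subset)
qed

text \<open>A nonnegative integrable function with integral 0 vanishes almost everywhere, and where
  the density is 0 so are the coordinates of \<alpha>.\<close>

lemma energy_zero_negligible:
  assumes \<alpha>: "\<alpha> \<in> hol_form X 2 UNIV" and B: "B \<in> sets borel" "closure B \<subseteq> chart_dom X c"
  defines "I \<equiv> Re (LINT z : chart_map X c ` B | lborel. energy_density g \<alpha> c (chart_inv X c z))"
  shows "I \<ge> 0"
    and "I = 0 \<Longrightarrow> negligible (chart_map X c ` {x \<in> B. \<alpha> c x [axis j 1, axis k 1] \<noteq> 0})"
proof -
  let ?f = "\<lambda>z. indicator (chart_map X c ` B) z *\<^sub>R energy_density g \<alpha> c (chart_inv X c z)"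
  have sub: "B \<subseteq> chart_dom X c" using B(2) closure_subset by blast
  have int: "integrable lborel ?f" using energy_integrable[OF \<alpha> B] unfolding set_integrable_def .
  then have intR: "integrable lborel (\<lambda>z. Re (?f z))" by (rule integrable_Re)
  have nonneg: "Re (?f z) \<ge> 0" and zero: "Re (?f z) = 0 \<Longrightarrow> z \<in> chart_map X c ` B \<Longrightarrow>
     \<alpha> c (chart_inv X c z) [axis j 1, axis k 1] = 0" for z
  proof -
    have "Re (?f z) \<ge> 0 \<and> (Re (?f z) = 0 \<longrightarrow> z \<in> chart_map X c ` B \<longrightarrow>
      \<alpha> c (chart_inv X c z) [axis j 1, axis k 1] = 0)"
    proof (cases "z \<in> chart_map X c ` B")
      case True
      then have "chart_inv X c z \<in> chart_dom X c" using sub by (auto simp: chart_inv_map)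
      then obtain q where "q \<ge> 0" "energy_density g \<alpha> c (chart_inv X c z) = complex_of_real q"
        "q = 0 \<longrightarrow> \<alpha> c (chart_inv X c z) [axis j 1, axis k 1] = 0"
        using energy_density_nonneg by blast
      then show ?thesis using True by simp
    qed simp
    then show "Re (?f z) \<ge> 0" "Re (?f z) = 0 \<Longrightarrow> z \<in> chart_map X c ` B \<Longrightarrow>
      \<alpha> c (chart_inv X c z) [axis j 1, axis k 1] = 0" by blast+
  qed
  have I: "I = integral\<^sup>L lborel (\<lambda>z. Re (?f z))"
    unfolding I_def set_lebesgue_integral_def by (rule integral_Re[OF int, symmetric])
  show "I \<ge> 0" unfolding I by (rule Bochner_Integration.integral_nonneg) (rule nonneg)
  assume "I = 0"
  then have "AE z in lborel. Re (?f z) = 0"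
    unfolding I using integral_nonneg_eq_0_iff_AE[OF intR] nonneg by simp
  \<comment> \<open>The passage to the completed measure is made because \<open>negligible\<close>
    sets are the null sets of \<open>lebesgue\<close>.\<close>
  then have "AE z in lebesgue. Re (?f z) = 0" by (rule AE_completion)
  then obtain N where N: "negligible N" "{z. Re (?f z) \<noteq> 0} \<subseteq> N"
    unfolding eventually_ae_filter_negligible by blast
  have "chart_map X c ` {x \<in> B. \<alpha> c x [axis j 1, axis k 1] \<noteq> 0} \<subseteq> N"
  proof
    fix z assume "z \<in> chart_map X c ` {x \<in> B. \<alpha> c x [axis j 1, axis k 1] \<noteq> 0}"
    then obtain x where x: "x \<in> B" "\<alpha> c x [axis j 1, axis k 1] \<noteq> 0" "z = chart_map X c x" by blast
    then have "Re (?f z) \<noteq> 0" using zero[of z] sub by (auto simp: chart_inv_map subset_iff)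
    then show "z \<in> N" using N(2) by blast
  qed
  then show "negligible (chart_map X c ` {x \<in> B. \<alpha> c x [axis j 1, axis k 1] \<noteq> 0})"
    using N(1) negligible_subset by blast
qed

text \<open>By bilinear expansion, vanishing coordinates in one chart, which the energy controls,
  mean that the form vanishes on all vectors, a property that can be moved to another chart.\<close>

lemma hol_form2_zero:
  assumes \<alpha>: "\<alpha> \<in> hol_form X 2 UNIV" and z: "\<And>j k. \<alpha> c x [axis j 1, axis k 1] = 0"
  shows "\<alpha> c x vs = 0"
proof (cases "x \<in> chart_dom X c \<inter> UNIV \<and> length vs = 2")
  case False
  then show ?thesis by (intro hol_form_zero[OF \<alpha>]) auto
next
  case True
  then obtain u w where vs: "vs = [u, w]" using length_2_cases by blast
  have x: "x \<in> chart_dom X c \<inter> UNIV" using True by blast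
  have l0: "\<alpha> c x [a *s p + b *s q, r] = a * \<alpha> c x [p, r] + b * \<alpha> c x [q, r]" for a b p q r
    using hol_form_linear[OF \<alpha> x, of "[p, r]" 0 a p b q] by simp
  have l1: "\<alpha> c x [r, a *s p + b *s q] = a * \<alpha> c x [r, p] + b * \<alpha> c x [r, q]" for a b p q r
    using hol_form_linear[OF \<alpha> x, of "[r, p]" 1 a p b q] by simp
  have s0: "\<alpha> c x [\<Sum>k\<in>I. a k *s p k, r] = (\<Sum>k\<in>I. a k * \<alpha> c x [p k, r])" for a p r and I :: "'n set"
  proof (induction I rule: infinite_finite_induct)
    case (insert k I)
    then show ?case using l0[of "a k" "p k" 1 "\<Sum>k\<in>I. a k *s p k" r] by simp
  qed (use l0[of 0 0 0 0 r] in simp_all)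
  have s1: "\<alpha> c x [r, \<Sum>k\<in>I. a k *s p k] = (\<Sum>k\<in>I. a k * \<alpha> c x [r, p k])" for a p r and I :: "'n set"
  proof (induction I rule: infinite_finite_induct)
    case (insert k I)
    then show ?case using l1[of r "a k" "p k" 1 "\<Sum>k\<in>I. a k *s p k"] by simp
  qed (use l1[of r 0 0 0 0] in simp_all)
  have "\<alpha> c x [axis j 1, w] = 0" for j
    using s1[of "axis j 1" "\<lambda>k. w $ k" "\<lambda>k. axis k 1" UNIV] vec_expansion[of w] by (simp add: z)
  then show ?thesis unfolding vs
    using s0[of "\<lambda>k. u $ k" "\<lambda>k. axis k 1" UNIV w] vec_expansion[of u] by simp
qed

text \<open>The support of \<open>\<alpha>\<close> meets each piece of the partition in a set that is null in the chart of the
  piece; coordinate changes preserve null sets, so its open image in any one chart is null, hence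
  empty.\<close>

theorem L2_inner_definite:
  assumes \<alpha>: "\<alpha> \<in> hol_form X 2 UNIV" and L: "Re (L2_inner X g \<alpha> \<alpha>) = 0"
  shows "\<alpha> = 0"
proof (rule ccontr)
  assume "\<alpha> \<noteq> 0"
  moreover have "\<alpha> = 0" if "\<And>c x j k. \<alpha> c x [axis j 1, axis k 1] = 0"
    by (intro ext) (simp only: hol_form2_zero[OF \<alpha> that] zero_fun_apply)
  ultimately have "\<not> (\<forall>c x j k. \<alpha> c x [axis j 1, axis k 1] = 0)" by auto
  then obtain c x j k where jk: "\<alpha> c x [axis j 1, axis k 1] \<noteq> 0" by blast
  have x: "x \<in> chart_dom X c"
    by (rule ccontr) (use jk hol_form_zero[OF \<alpha>, of x c "[axis j 1, axis k 1]"] in simp)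
  define P where "P = (SOME P. chart_partition X P)"
  have P: "chart_partition X P" unfolding P_def using chart_partition_exists by (rule someI_ex)
  note P' = P[unfolded chart_partition_def]
  have fin: "finite P" by (rule conjunct1[OF P'])
  have cover: "(\<Union>p\<in>P. snd p) = UNIV" by (rule conjunct2[OF conjunct2[OF conjunct2[OF P']]])
  have PB: "B \<in> sets borel \<and> closure B \<subseteq> chart_dom X d" if "(d, B) \<in> P" for d B
    using bspec[OF conjunct1[OF conjunct2[OF P']] that] by simp
  define I where "I d B = Re (LINT z : chart_map X d ` B | lborel. energy_density g \<alpha> d (chart_inv X d z))" for d B
  have sum0: "(\<Sum>(d,B)\<in>P. I d B) = 0"
    using L unfolding L2_inner_def volume_integral_def P_def[symmetric] I_def energy_density_def
    by (simp only: Re_sum case_prod_unfold)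
  have nn: "I d B \<ge> 0" if "(d, B) \<in> P" for d B
    unfolding I_def using PB[OF that] by (intro energy_zero_negligible(1)[OF \<alpha>]) auto
  have I0: "I d B = 0" if "(d, B) \<in> P" for d B
  proof -
    have "\<forall>p\<in>P. (case p of (d, B) \<Rightarrow> I d B) = 0"
      using sum0
      by (subst (asm) sum_nonneg_eq_0_iff[OF fin]) (use nn in auto)
    from bspec[OF this that] show ?thesis by simp
  qed
  \<comment> \<open>All index pairs are collected because a coordinate change mixes the components:
    one nonzero component in chart \<open>c\<close> only yields some nonzero component in chart
    \<open>d\<close>.\<close>
  define Z where "Z d B = (\<Union>j. \<Union>k. chart_map X d ` {y \<in> B. \<alpha> d y [axis j 1, axis k 1] \<noteq> 0})" for d B
  have Z: "negligible (Z d B)" if "(d, B) \<in> P" for d B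
  proof -
    have N: "negligible (chart_map X d ` {y \<in> B. \<alpha> d y [axis j 1, axis k 1] \<noteq> 0})" for j k
      using I0[OF that] PB[OF that] unfolding I_def
      by (intro energy_zero_negligible(2)[OF \<alpha>]) auto
    have "negligible (\<Union>k. chart_map X d ` {y \<in> B. \<alpha> d y [axis j 1, axis k 1] \<noteq> 0})" for j
      by (rule negligible_Union[OF finite_imageI[OF finite]]) (use N in blast)
    then show ?thesis
      unfolding Z_def by (intro negligible_Union[OF finite_imageI[OF finite]]) blast
  qed
  define f where "f z = \<alpha> c (chart_inv X c z) [axis j 1, axis k 1]" for z
  define S where "S = chart_map X c ` chart_dom X c \<inter> f -` (- {0})"
  have "continuous_on (chart_map X c ` chart_dom X c) f"
    unfolding f_def
    by (rule holomorphic_Cn_continuous_on[OF hol_form_holomorphic[OF \<alpha>, of c "[axis j 1, axis k 1]",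
            unfolded chart_holomorphic_def Int_UNIV_right]])
  then have "open S" unfolding S_def
    using open_chart_image[OF open_UNIV, of c] by (intro continuous_open_preimage) auto
  moreover have "chart_map X c x \<in> S" using x jk by (auto simp: S_def f_def chart_inv_map)
  moreover have "negligible S"
  proof (rule negligible_subset)
    define T where "T d B = (\<lambda>z. chart_map X c (chart_inv X d z)) ` (Z d B \<inter> chart_map X d ` (chart_dom X d \<inter> chart_dom X c))" for d B
    show "negligible (\<Union>(d,B)\<in>P. T d B)"
    proof (intro negligible_Union finite_imageI fin ballI)
      fix N assume "N \<in> (\<lambda>(d, B). T d B) ` P"
      then obtain d B where dB: "(d, B) \<in> P" "N = T d B" by auto
      have "(\<lambda>z. chart_map X c (chart_inv X d z)) differentiable (at z)"
        if "z \<in> chart_map X d ` (chart_dom X d \<inter> chart_dom X c)" for z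
      proof -
        from that obtain y where y: "y \<in> chart_dom X d \<inter> chart_dom X c" "z = chart_map X d y" by blast
        show ?thesis unfolding y(2) by (rule differentiableI[OF chart_jac_has_derivative(1)[OF y(1)]])
      qed
      then have "(\<lambda>z. chart_map X c (chart_inv X d z)) differentiable_on (Z d B \<inter> chart_map X d ` (chart_dom X d \<inter> chart_dom X c))"
        by (intro differentiable_at_imp_differentiable_on) simp
      then show "negligible N"
        unfolding dB(2) T_def
        by (intro negligible_differentiable_image_negligible[OF order_refl negligible_subset[OF Z[OF dB(1)] inf_le1]])
    qed
    show "S \<subseteq> (\<Union>(d,B)\<in>P. T d B)"
    proof
      fix z assume "z \<in> S"
      then obtain y where y: "y \<in> chart_dom X c" "z = chart_map X c y" "\<alpha> c y [axis j 1, axis k 1] \<noteq> 0"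
        unfolding S_def f_def by (auto simp: chart_inv_map)
      have "y \<in> (\<Union>p\<in>P. snd p)" by (simp only: cover UNIV_I)
      then obtain d B where dB: "(d, B) \<in> P" "y \<in> B" by (metis UN_E prod.collapse)
      then have yd: "y \<in> chart_dom X d" using PB[OF dB(1)] closure_subset by blast
      have "\<alpha> d y (map (chart_jac X c d y) [axis j 1, axis k 1]) \<noteq> 0"
        using hol_form_transform[OF \<alpha>, of y c d "[axis j 1, axis k 1]"] y yd by simp
      then obtain j' k' where "\<alpha> d y [axis j' 1, axis k' 1] \<noteq> 0" using hol_form2_zero[OF \<alpha>] by blast
      then have "chart_map X d y \<in> Z d B" unfolding Z_def using dB(2) by blast
      then have "z \<in> T d B" unfolding T_def using y yd
        by (intro image_eqI[of _ _ "chart_map X d y"]) (auto simp: chart_inv_map)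
      then show "z \<in> (\<Union>(d,B)\<in>P. T d B)" using dB(1) by blast
    qed
  qed
  ultimately show False using open_not_negligible by blast
qed

text \<open>The second slot contributes the conjugate of the factor, so a real factor produces a
  square. Constants leave the Lebesgue integral unconditionally, which is why \<alpha> is
  arbitrary.\<close>

lemma L2_inner_scale:
  "L2_inner X g (\<lambda>c x vs. complex_of_real t * \<alpha> c x vs) (\<lambda>c x vs. complex_of_real t * \<alpha> c x vs)
     = complex_of_real (t\<^sup>2) * L2_inner X g \<alpha> \<alpha>"
proof -
  have f: "form2_inner g (\<lambda>c x vs. complex_of_real t * \<alpha> c x vs) (\<lambda>c x vs. complex_of_real t * \<alpha> c x vs) c x
     = complex_of_real (t\<^sup>2) * form2_inner g \<alpha> \<alpha> c x" for c x
    unfolding form2_inner_def Let_def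
    by (simp add: sum_distrib_left power2_eq_square mult_ac)
  show ?thesis
    unfolding L2_inner_def volume_integral_def f
    by (simp add: sum_distrib_left case_prod_unfold mult.assoc)
qed

end

theorem corollary1:
  fixes X :: "('x::t2_space, 'c, 'n::finite) atlas"
    and g :: "('x, 'c, 'n) herm_metric"
    and F :: "('x, 'i) line_bundle"
    and h :: "'i \<Rightarrow> 'x \<Rightarrow> real"
    and D :: "('x, 'i, 'c, 'n) conn"
  assumes "compact_kaehler_manifold X g"
    and "hermitian_line_bundle X F h"
    and "hodge_number_p0 X 2 \<le> hodge_number_p0 X 1"
    and "yang_mills_connection X g F h D"
    and "generic_connection X F h D"
  shows "flat_connection X F D"
proof -
  interpret compact_kaehler X g
    using assms(1) unfolding compact_kaehler_manifold_def by unfold_locales auto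
  interpret line_bundle_connection X F D
    using assms(2,4) unfolding hermitian_line_bundle_def yang_mills_connection_def by unfold_locales auto
  \<comment> \<open>By \<open>antiherm_form_eq\<close> the curvature form itself lies in the target
    of the map whose surjectivity is genericity.\<close>
  have "curv \<in> conn_end X F D ` hol_form X 1 UNIV"
    using assms(5) curv_hol_form unfolding generic_connection_def antiherm_form_eq by simp
  then obtain E where E: "E \<in> hol_form X 1 UNIV" "ext_deriv X UNIV E = curv"
    by (auto simp: conn_end_eq)
  define L where "L = Re (L2_inner X g curv curv)"
  have "yang_mills_functional X g F (conn_add D (\<lambda>c x vs. complex_of_real \<epsilon> * E c x vs)) = (1 + \<epsilon>)\<^sup>2 * L" for \<epsilon>
  proof -
    have "curvature_form X F (conn_add D (\<lambda>c x vs. complex_of_real \<epsilon> * E c x vs)) =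
        (\<lambda>c x vs. complex_of_real (1 + \<epsilon>) * curv c x vs)"
      using curvature_form_conn_add[OF E] by simp
    then show ?thesis
      unfolding yang_mills_functional_def L_def by (simp only: L2_inner_scale Re_complex_of_real) simp
  qed
  then have "((\<lambda>\<epsilon>. (1 + \<epsilon>)\<^sup>2 * L) has_real_derivative 0) (at 0)"
    using bspec[OF conjunct2[OF assms(4)[unfolded yang_mills_connection_def antiherm_form_eq]] E(1)] by simp
  moreover have "((\<lambda>\<epsilon>. (1 + \<epsilon>)\<^sup>2 * L) has_real_derivative 2 * L) (at 0)"
    by (auto intro!: derivative_eq_intros)
  ultimately have "L = 0" using DERIV_unique by fastforce
  then show ?thesis
    unfolding L_def by (intro flat_if_curv_zero L2_inner_definite curv_hol_form)
qed

end
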